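(* Let $\Gamma$ be a rational smooth affine curve and let $g\in\mathrm{Aut}(\Gamma)$. (1) If $g$ fixes at most one point of $\Gamma$, then there exist a closed embedding $\tau\colon\Gamma\to\mathbb{A}^2$ and $h\in\mathrm{Aut}(\mathbb{A}^2)$ with $h\circ\tau=\tau\circ g$. (2) If $g$ has finite order $n>1$ with $n$ odd and $g$ fixes exactly two points of $\Gamma$, then there is no closed embedding $\tau\colon\Gamma\to\mathbb{A}^2$ for which there exists $h\in\mathrm{Aut}(\mathbb{A}^2)$ with $h\circ\tau=\tau\circ g$.
   Context: All varieties are over $\mathbb{C}$. A rational smooth affine curve is a smooth affine curve isomorphic to $\mathbb{P}^1\setminus\Lambda$ for some non-empty finite set $\Lambda\subset\mathbb{P}^1$; its automorphisms are identified with the automorphisms of $\mathbb{P}^1$ preserving $\Lambda$. *)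

theory Defs
  imports "HOL-Computational_Algebra.Polynomial"
begin

datatype p1 = Fin complex | Inf

fun moeb :: "complex \<Rightarrow> complex \<Rightarrow> complex \<Rightarrow> complex \<Rightarrow> p1 \<Rightarrow> p1" where
  "moeb a b c d (Fin z) = (if c * z + d \<noteq> 0 then Fin ((a * z + b) / (c * z + d)) else Inf)"
| "moeb a b c d Inf = (if c \<noteq> 0 then Fin (a / c) else Inf)"

text \<open>Automorphisms of the rational curve P^1 minus Lambda: automorphisms of P^1 preserving Lambda.\<close>
definition curve_aut :: "p1 set \<Rightarrow> (p1 \<Rightarrow> p1) \<Rightarrow> bool" where
  "curve_aut \<Lambda> g \<longleftrightarrow> (\<exists>a b c d. a * d - b * c \<noteq> 0 \<and> g = moeb a b c d \<and> g ` \<Lambda> = \<Lambda>)"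

definition regular_on :: "p1 set \<Rightarrow> (p1 \<Rightarrow> complex) \<Rightarrow> bool" where
  "regular_on \<Gamma> f \<longleftrightarrow> (\<exists>p q :: complex poly. q \<noteq> 0 \<and>
      (\<forall>z. Fin z \<in> \<Gamma> \<longrightarrow> poly q z \<noteq> 0 \<and> f (Fin z) = poly p z / poly q z) \<and>
      (Inf \<in> \<Gamma> \<longrightarrow> degree p \<le> degree q \<and>
          f Inf = (if degree p = degree q then lead_coeff p / lead_coeff q else 0)))"

definition poly2 :: "(complex \<times> complex \<Rightarrow> complex) \<Rightarrow> bool" where
  "poly2 F \<longleftrightarrow> (\<exists>cf :: nat \<times> nat \<Rightarrow> complex. finite {ij. cf ij \<noteq> 0} \<and>
      (\<forall>x y. F (x, y) = (\<Sum>ij\<in>{ij. cf ij \<noteq> 0}. cf ij * x ^ fst ij * y ^ snd ij)))"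

definition poly_map2 :: "(complex \<times> complex \<Rightarrow> complex \<times> complex) \<Rightarrow> bool" where
  "poly_map2 h \<longleftrightarrow> poly2 (fst \<circ> h) \<and> poly2 (snd \<circ> h)"

definition aut_A2 :: "(complex \<times> complex \<Rightarrow> complex \<times> complex) \<Rightarrow> bool" where
  "aut_A2 h \<longleftrightarrow> poly_map2 h \<and> (\<exists>k. poly_map2 k \<and> h \<circ> k = id \<and> k \<circ> h = id)"

text \<open>Closed embedding Gamma -> A^2: a morphism whose comorphism C[x,y] -> O(Gamma) is surjective.\<close>
definition closed_emb :: "p1 set \<Rightarrow> (p1 \<Rightarrow> complex \<times> complex) \<Rightarrow> bool" where
  "closed_emb \<Gamma> \<tau> \<longleftrightarrow> regular_on \<Gamma> (fst \<circ> \<tau>) \<and> regular_on \<Gamma> (snd \<circ> \<tau>) \<and>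
     (\<forall>f. regular_on \<Gamma> f \<longrightarrow> (\<exists>F. poly2 F \<and> (\<forall>z\<in>\<Gamma>. f z = F (\<tau> z))))"

definition aut_order :: "(p1 \<Rightarrow> p1) \<Rightarrow> nat \<Rightarrow> bool" where
  "aut_order g n \<longleftrightarrow> 0 < n \<and> (g ^^ n) = id \<and> (\<forall>m. 0 < m \<and> m < n \<longrightarrow> (g ^^ m) \<noteq> id)"

end

(* Part 1: a Moebius transformation g with at most one fixed point on the curve has a fixed point in
   Lambda (otherwise it is a translation in a suitable coordinate, and preserves no finite set). Moving
   that point to infinity, g becomes t |-> alpha t + beta, and with q the product of the t - s over the
   finite points s of Lambda, the embedding t |-> (t, 1 / q t) makes g the restriction of an affine map of the plane.

   Part 2: let h extend g to the plane, let F be an equation of the embedded curve, and p a fixed point.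
   The curve is smooth, so the Jacobian of h at p is the product of the multiplier of g at p (the
   tangent eigenvalue) and the factor c with F o h = c F (the conormal eigenvalue). The Jacobian and c
   are constants, so g has the same multiplier at its two fixed points. As these multipliers are
   mutually inverse, g is an involution, which is impossible if the order is odd. *)
theory Submission
  imports Defs "HOL-Analysis.Product_Vector" "HOL-Computational_Algebra.Polynomial_Factorial"
    "HOL-Computational_Algebra.Field_as_Ring" "HOL-Computational_Algebra.Fundamental_Theorem_Algebra"
begin

section \<open>Polynomial functions of two variables\<close>

text \<open>Smoothness and the equation \<open>F\<close> both have to be extracted from surjectivity
  of the comorphism. It makes the parameter \<open>t\<close> a polynomial in the two coordinates, so
  the velocity vector never vanishes; it also makes the divided differences of the coordinates
  polynomials, which yields at each point an element of the ideal with non-zero differential. The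
  ideal is principal (least degree in \<open>y\<close>, pseudo-division over \<open>C[x]\<close>,
  Gauss's lemma), and its generator \<open>F\<close> divides that element, so \<open>dF\<close>
  cannot vanish on the curve. \<open>F o h\<close> and \<open>F\<close> divide each other, hence
  differ by a unit of \<open>C[x,y]\<close>, that is a constant; the same fact makes the Jacobian
  constant. All calculus takes place in an affine coordinate with a point of \<open>Lambda\<close>
  at infinity, so embeddings must be carried along Moebius maps, which binary forms achieve without
  splitting into charts. The involution is finally read off from the matrix of \<open>g\<close>:
  equal multipliers at two fixed points force trace zero or the identity.\<close>

definition bieval :: "complex poly poly \<Rightarrow> complex \<times> complex \<Rightarrow> complex" where
  "bieval P z = poly (poly P [:snd z:]) (fst z)"

lemma bieval_simps [simp]:
  "bieval 0 z = 0"
  "bieval 1 z = 1"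
  "bieval (P + Q) z = bieval P z + bieval Q z"
  "bieval (P - Q) z = bieval P z - bieval Q z"
  "bieval (P * Q) z = bieval P z * bieval Q z"
  "bieval (smult p P) z = poly p (fst z) * bieval P z"
  "bieval (pCons p P) z = poly p (fst z) + snd z * bieval P z"
  by (simp_all add: bieval_def)

text \<open>For fixed \<open>y\<close>, a polynomial in \<open>x\<close> with only zero values is
  zero. So every constant \<open>[:y:]\<close> is a root of \<open>P\<close> over the domain
  \<open>complex poly\<close>, while a non-zero \<open>P\<close> has finitely many roots.\<close>

lemma bieval_eq_0_imp:
  assumes "\<And>z. bieval P z = 0"
  shows "P = 0"
proof (rule ccontr)
  assume "P \<noteq> 0"
  have "poly P [:y:] = 0" for y
    using assms[of "(_, y)"] by (auto simp: bieval_def intro!: poly_all_0_iff_0[THEN iffD1])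
  then have "range (\<lambda>y. [:y:]) \<subseteq> {p. poly P p = 0}"
    by auto
  then have "finite (range (\<lambda>y::complex. [:y:]))"
    using poly_roots_finite[OF \<open>P \<noteq> 0\<close>] by (rule finite_subset)
  moreover have "inj (\<lambda>y::complex. [:y:])"
    by (auto intro: injI)
  ultimately show False
    using infinite_UNIV_char_0 finite_imageD by blast
qed

lemma bieval_inject: "bieval P = bieval Q \<longleftrightarrow> P = Q"
  using bieval_eq_0_imp[of "P - Q"] by auto

text \<open>Bridge to the iterated ring \<open>C[x][y]\<close>, with \<open>x\<close> in the
  coefficients and \<open>y\<close> outside, where divisibility, contents and pseudo-division are
  available.\<close>

lemma poly2_iff_bieval: "poly2 F \<longleftrightarrow> (\<exists>P. F = bieval P)"
proof
  assume "poly2 F"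
  then obtain cf where fin: "finite {ij. cf ij \<noteq> 0}"
    and F: "\<And>x y. F (x, y) = (\<Sum>ij\<in>{ij. cf ij \<noteq> 0}. cf ij * x ^ fst ij * y ^ snd ij)"
    unfolding poly2_def by blast
  have "F z = bieval (\<Sum>ij\<in>{ij. cf ij \<noteq> 0}. monom (monom (cf ij) (fst ij)) (snd ij)) z" for z
  proof (cases z)
    case (Pair x y)
    then show ?thesis
      unfolding bieval_def poly_sum by (simp add: F poly_monom)
  qed
  then show "\<exists>P. F = bieval P"
    by blast
next
  assume "\<exists>P. F = bieval P"
  then obtain P where F: "F = bieval P" by blast
  \<comment> \<open>A crude common bound on the \<open>x\<close>-degrees of all coefficients, so
    that the exponents lie in a rectangle.\<close>
  define N where "N = (\<Sum>j\<le>degree P. degree (coeff P j))"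
  define cf where "cf = (\<lambda>(i, j). coeff (coeff P j) i)"
  have N: "degree (coeff P j) \<le> N" for j
  proof (cases "j \<le> degree P")
    case True
    then show ?thesis
      unfolding N_def by (intro member_le_sum) auto
  qed (simp add: coeff_eq_0)
  have sub: "{ij. cf ij \<noteq> 0} \<subseteq> {..N} \<times> {..degree P}"
  proof clarsimp
    fix i j assume "cf (i, j) \<noteq> 0"
    then have "coeff (coeff P j) i \<noteq> 0" by (simp add: cf_def)
    then have "i \<le> degree (coeff P j)" "coeff P j \<noteq> 0"
      by (auto intro: le_degree)
    then show "i \<le> N \<and> j \<le> degree P"
      using N[of j] by (auto intro: le_degree)
  qed
  have poly_N: "poly (coeff P j) x = (\<Sum>i\<le>N. coeff (coeff P j) i * x ^ i)" for j x
    using N[of j] by (simp add: poly_altdef coeff_eq_0 sum.mono_neutral_left)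
  have "F (x, y) = (\<Sum>ij\<in>{ij. cf ij \<noteq> 0}. cf ij * x ^ fst ij * y ^ snd ij)" for x y
  proof -
    have "F (x, y) = (\<Sum>j\<le>degree P. \<Sum>i\<le>N. coeff (coeff P j) i * x ^ i * y ^ j)"
      by (simp add: F bieval_def poly_altdef[of P] poly_sum poly_N sum_distrib_right)
    also have "\<dots> = (\<Sum>i\<le>N. \<Sum>j\<le>degree P. coeff (coeff P j) i * x ^ i * y ^ j)"
      by (rule sum.swap)
    also have "\<dots> = (\<Sum>ij\<in>{..N} \<times> {..degree P}. cf ij * x ^ fst ij * y ^ snd ij)"
      by (simp add: sum.cartesian_product cf_def case_prod_beta)
    also have "\<dots> = (\<Sum>ij\<in>{ij. cf ij \<noteq> 0}. cf ij * x ^ fst ij * y ^ snd ij)"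
      using sub by (intro sum.mono_neutral_right) auto
    finally show ?thesis .
  qed
  then show "poly2 F"
    unfolding poly2_def using finite_subset[OF sub] by blast
qed

lemma poly2_bieval [simp]: "poly2 (bieval P)"
  by (auto simp: poly2_iff_bieval)

lemma poly2E:
  assumes "poly2 F"
  obtains P where "F = bieval P"
  using assms by (auto simp: poly2_iff_bieval)

section \<open>Closure properties and units of the ring of polynomial functions\<close>

lemma poly2_const: "poly2 (\<lambda>z. c)"
  and poly2_fst: "poly2 fst"
  and poly2_snd: "poly2 snd"
proof -
  have eqs: "(\<lambda>z. c) = bieval [:[:c:]:]" "fst = bieval [:[:0, 1:]:]" "snd = bieval [:0, 1:]"
    by (auto simp: fun_eq_iff)
  show "poly2 (\<lambda>z. c)" "poly2 fst" "poly2 snd"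
    unfolding eqs by (rule poly2_bieval)+
qed

lemma poly2_add:
  assumes "poly2 F" "poly2 G"
  shows "poly2 (\<lambda>z. F z + G z)"
proof -
  obtain P Q where "F = bieval P" "G = bieval Q"
    using assms by (auto elim!: poly2E)
  then have "(\<lambda>z. F z + G z) = bieval (P + Q)"
    by (simp add: fun_eq_iff)
  then show ?thesis by simp
qed

lemma poly2_mult:
  assumes "poly2 F" "poly2 G"
  shows "poly2 (\<lambda>z. F z * G z)"
proof -
  obtain P Q where "F = bieval P" "G = bieval Q"
    using assms by (auto elim!: poly2E)
  then have "(\<lambda>z. F z * G z) = bieval (P * Q)"
    by (simp add: fun_eq_iff)
  then show ?thesis by simp
qed

lemma poly2_diff:
  assumes "poly2 F" "poly2 G"
  shows "poly2 (\<lambda>z. F z - G z)"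
proof -
  have "poly2 (\<lambda>z. F z + (- 1) * G z)"
    using assms by (intro poly2_add poly2_mult poly2_const)
  then show ?thesis by simp
qed

lemma poly2_poly:
  assumes "poly2 F"
  shows "poly2 (\<lambda>z. poly p (F z))"
  by (induction p) (simp_all add: assms poly2_add poly2_mult poly2_const)

lemma poly2_comp:
  assumes "poly2 F" "poly_map2 h"
  shows "poly2 (\<lambda>z. F (h z))"
proof -
  obtain P where F: "F = bieval P"
    using assms(1) by (rule poly2E)
  have h: "poly2 (\<lambda>z. fst (h z))" "poly2 (\<lambda>z. snd (h z))"
    using assms(2) by (simp_all add: poly_map2_def o_def)
  have "poly2 (\<lambda>z. bieval P (h z))"
    by (induction P) (simp_all add: h poly2_add poly2_mult poly2_const poly2_poly)
  then show ?thesis by (simp add: F)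
qed

text \<open>Evaluation is injective, so the identity holds in \<open>C[x][y]\<close>; the
  description of units of a polynomial ring is then applied twice, to the outer and to the inner
  variable.\<close>

lemma poly2_unit_const:
  assumes "poly2 F" "poly2 G" "\<And>z. F z * G z = 1"
  shows "\<exists>c. c \<noteq> 0 \<and> (\<forall>z. F z = c)"
proof -
  obtain P Q where PQ: "F = bieval P" "G = bieval Q"
    using assms by (auto elim!: poly2E)
  have "bieval (P * Q) = bieval 1"
    using assms(3) by (simp add: PQ fun_eq_iff)
  then have "P * Q = 1"
    by (simp add: bieval_inject)
  then have "P dvd 1"
    by (metis dvd_triv_left)
  then obtain p where "P = [:p:]" "p dvd 1"
    by (auto simp: is_unit_poly_iff)
  then obtain c where "P = [:[:c:]:]"
    by (auto simp: is_unit_poly_iff)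
  then have F: "F z = c" for z
    by (simp add: PQ)
  then have "c \<noteq> 0"
    using assms(3) by (metis mult_zero_left zero_neq_one)
  then show ?thesis using F by blast
qed

text \<open>\<open>map_poly pderiv\<close> differentiates the coefficients, so it is the partial
  derivative in \<open>x\<close>, and \<open>pderiv\<close> is the one in \<open>y\<close>. Stating
  them as a Frechet derivative gives access to the chain rule.\<close>

lemma has_derivative_bieval:
  "(bieval P has_derivative
     (\<lambda>w. bieval (map_poly pderiv P) z * fst w + bieval (pderiv P) z * snd w)) (at z)"
proof (induction P)
  case 0
  then show ?case by (simp add: bieval_def[abs_def])
next
  case (pCons p P)
  have "((\<lambda>z. poly p (fst z)) has_derivative (\<lambda>w. poly (pderiv p) (fst z) * fst w)) (at z)"
    using has_derivative_compose[OF has_derivative_fst[OF has_derivative_ident]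
        poly_DERIV[unfolded has_field_derivative_def]] .
  moreover have "((\<lambda>z. snd z * bieval P z) has_derivative
      (\<lambda>w. snd z * (bieval (map_poly pderiv P) z * fst w + bieval (pderiv P) z * snd w)
           + snd w * bieval P z)) (at z)"
    by (intro has_derivative_mult has_derivative_snd has_derivative_ident pCons.IH)
  ultimately have "((\<lambda>z. poly p (fst z) + snd z * bieval P z) has_derivative
      (\<lambda>w. poly (pderiv p) (fst z) * fst w +
        (snd z * (bieval (map_poly pderiv P) z * fst w + bieval (pderiv P) z * snd w)
           + snd w * bieval P z))) (at z)"
    by (rule has_derivative_add)
  moreover have "map_poly pderiv (pCons p P) = pCons (pderiv p) (map_poly pderiv P)"
    using pCons.hyps by (auto simp: map_poly_pCons)
  moreover have "bieval (pCons p P) = (\<lambda>z. poly p (fst z) + snd z * bieval P z)"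
    by (simp add: fun_eq_iff)
  ultimately show ?case
    by (simp add: pderiv_pCons distrib_left distrib_right add_ac mult_ac)
qed

lemma poly2_has_derivative:
  assumes "poly2 F"
  shows "\<exists>Fx Fy. poly2 Fx \<and> poly2 Fy \<and>
    (\<forall>z. (F has_derivative (\<lambda>w. Fx z * fst w + Fy z * snd w)) (at z))"
proof -
  obtain P where "F = bieval P"
    using assms by (rule poly2E)
  with has_derivative_bieval[of P] poly2_bieval show ?thesis
    by blast
qed

lemma has_derivative_linear_form_unique:
  fixes F :: "complex \<times> complex \<Rightarrow> complex"
  assumes "(F has_derivative (\<lambda>w. a * fst w + b * snd w)) (at z)"
    and "(F has_derivative (\<lambda>w. c * fst w + d * snd w)) (at z)"
  shows "a = c" "b = d"
proof -
  have *: "(\<lambda>w. a * fst w + b * snd w) = (\<lambda>w. c * fst w + d * snd w)"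
    using assms by (rule has_derivative_unique)
  show "a = c" "b = d"
    using fun_cong[OF *, of "(1, 0)"] fun_cong[OF *, of "(0, 1)"] by simp_all
qed

text \<open>Gauss's lemma: contents multiply, so with \<open>content F = 1\<close> the scalar
  \<open>a\<close> divides the cofactor and cancels. It removes the scalar that pseudo-division
  introduces.\<close>

lemma primitive_dvd_smult:
  fixes F G :: "'a :: {factorial_ring_gcd, normalization_semidom_multiplicative} poly"
  assumes "content F = 1" "F dvd smult a G" "a \<noteq> 0"
  shows "F dvd G"
proof -
  obtain Q where Q: "smult a G = F * Q"
    using assms(2) by (elim dvdE)
  have "content (smult a G) = content Q"
    by (simp add: Q content_mult assms(1))
  then have "normalize a * content G = content Q"
    by simp
  then have "a dvd content Q"
    by (metis dvd_triv_left normalize_dvd_iff)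
  then have "[:a:] dvd Q"
    by (simp add: const_poly_dvd_iff_dvd_content)
  then obtain Q' where "Q = smult a Q'"
    by (elim dvdE) simp
  then have "smult a G = smult a (F * Q')"
    using Q by simp
  then have "G = F * Q'"
    using assms(3) by (simp only: smult_cancel)
  then show ?thesis by simp
qed

lemma poly2_mult_eq_0:
  assumes "poly2 F" "poly2 G" "\<And>z. F z * G z = 0"
  shows "(\<forall>z. F z = 0) \<or> (\<forall>z. G z = 0)"
proof -
  obtain P Q where PQ: "F = bieval P" "G = bieval Q"
    using assms by (auto elim!: poly2E)
  have "P * Q = 0"
    using assms(3) by (intro bieval_eq_0_imp) (simp add: PQ)
  then show ?thesis
    by (auto simp: PQ)
qed

lemma poly2_map_swap: "poly_map2 prod.swap"
  by (simp add: poly_map2_def o_def poly2_fst poly2_snd)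

lemma has_derivative_linear_form_compose:
  fixes F :: "complex \<times> complex \<Rightarrow> complex"
  assumes "(F has_derivative (\<lambda>w. a * fst w + b * snd w)) (at (h z))"
    and "((\<lambda>z. fst (h z)) has_derivative (\<lambda>w. p * fst w + q * snd w)) (at z)"
    and "((\<lambda>z. snd (h z)) has_derivative (\<lambda>w. r * fst w + s * snd w)) (at z)"
  shows "((\<lambda>z. F (h z)) has_derivative
           (\<lambda>w. (a * p + b * r) * fst w + (a * q + b * s) * snd w)) (at z)"
proof -
  have "(h has_derivative (\<lambda>w. (p * fst w + q * snd w, r * fst w + s * snd w))) (at z)"
    using has_derivative_Pair[OF assms(2,3)] by simp
  from has_derivative_compose[OF this assms(1)] show ?thesis
    by (simp add: algebra_simps)
qed

lemma has_derivative_linear_form_curve: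
  fixes F :: "complex \<times> complex \<Rightarrow> complex"
  assumes "(F has_derivative (\<lambda>w. a * fst w + b * snd w)) (at (X t, Y t))"
    and "(X has_field_derivative D) (at t)" and "(Y has_field_derivative E) (at t)"
  shows "((\<lambda>t. F (X t, Y t)) has_field_derivative (a * D + b * E)) (at t)"
proof -
  have "((\<lambda>t. (X t, Y t)) has_derivative (\<lambda>u. (D * u, E * u))) (at t)"
    using assms(2,3) by (intro has_derivative_Pair) (simp_all add: has_field_derivative_def)
  from has_derivative_compose[OF this assms(1)]
  have "((\<lambda>t. F (X t, Y t)) has_derivative (\<lambda>u. a * (D * u) + b * (E * u))) (at t)"
    by simp
  moreover have "(\<lambda>u. a * (D * u) + b * (E * u)) = (*) (a * D + b * E)"
    by (simp add: fun_eq_iff algebra_simps)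
  ultimately show ?thesis
    by (simp only: has_field_derivative_def)
qed

lemma has_derivative_fst_linear_form:
    "(fst has_derivative (\<lambda>w. 1 * fst w + 0 * snd w)) (at (z :: complex \<times> complex))"
  and has_derivative_snd_linear_form:
    "(snd has_derivative (\<lambda>w. 0 * fst w + 1 * snd w)) (at (z :: complex \<times> complex))"
  using has_derivative_fst[OF has_derivative_ident] has_derivative_snd[OF has_derivative_ident]
  by simp_all

text \<open>The Jacobian of \<open>h\<close> at \<open>z\<close> times that of the inverse at
  \<open>h z\<close> is 1, and polynomial units are constant.\<close>

lemma aut_A2_jacobian_const:
  assumes "aut_A2 h"
  shows "\<exists>p q r s J. J \<noteq> 0 \<and>
    (\<forall>z. ((\<lambda>z. fst (h z)) has_derivative (\<lambda>w. p z * fst w + q z * snd w)) (at z)) \<and>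
    (\<forall>z. ((\<lambda>z. snd (h z)) has_derivative (\<lambda>w. r z * fst w + s z * snd w)) (at z)) \<and>
    (\<forall>z. p z * s z - q z * r z = J)"
proof -
  from assms obtain k where h: "poly_map2 h" and k: "poly_map2 k" and kh: "\<And>z. k (h z) = z"
    by (auto simp: aut_A2_def fun_eq_iff)
  have comps: "poly2 (\<lambda>z. fst (h z))" "poly2 (\<lambda>z. snd (h z))"
    "poly2 (\<lambda>z. fst (k z))" "poly2 (\<lambda>z. snd (k z))"
    using h k by (simp_all add: poly_map2_def o_def)
  obtain p q where pq: "poly2 p" "poly2 q"
    and h1: "\<And>z. ((\<lambda>z. fst (h z)) has_derivative (\<lambda>w. p z * fst w + q z * snd w)) (at z)"
    using poly2_has_derivative[OF comps(1)] by blast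
  obtain r s where rs: "poly2 r" "poly2 s"
    and h2: "\<And>z. ((\<lambda>z. snd (h z)) has_derivative (\<lambda>w. r z * fst w + s z * snd w)) (at z)"
    using poly2_has_derivative[OF comps(2)] by blast
  obtain p' q' where pq': "poly2 p'" "poly2 q'"
    and k1: "\<And>z. ((\<lambda>z. fst (k z)) has_derivative (\<lambda>w. p' z * fst w + q' z * snd w)) (at z)"
    using poly2_has_derivative[OF comps(3)] by blast
  obtain r' s' where rs': "poly2 r'" "poly2 s'"
    and k2: "\<And>z. ((\<lambda>z. snd (k z)) has_derivative (\<lambda>w. r' z * fst w + s' z * snd w)) (at z)"
    using poly2_has_derivative[OF comps(4)] by blast
  have "(p z * s z - q z * r z) * (p' (h z) * s' (h z) - q' (h z) * r' (h z)) = 1" for z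
  proof -
    \<comment> \<open>Row by row, the chain rule for \<open>k o h = id\<close> says that the two
      Jacobian matrices multiply to the identity matrix.\<close>
    note d1 = has_derivative_linear_form_compose[OF k1 h1 h2, unfolded kh, of z]
    note d2 = has_derivative_linear_form_compose[OF k2 h1 h2, unfolded kh, of z]
    have "p' (h z) * p z + q' (h z) * r z = 1" "p' (h z) * q z + q' (h z) * s z = 0"
      using has_derivative_linear_form_unique[OF d1 has_derivative_fst_linear_form] by simp_all
    moreover have "r' (h z) * p z + s' (h z) * r z = 0" "r' (h z) * q z + s' (h z) * s z = 1"
      using has_derivative_linear_form_unique[OF d2 has_derivative_snd_linear_form] by simp_all
    ultimately show ?thesis
      by algebra
  qed
  moreover have "poly2 (\<lambda>z. p z * s z - q z * r z)"
    by (rule poly2_diff[OF poly2_mult[OF pq(1) rs(2)] poly2_mult[OF pq(2) rs(1)]])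
  moreover have "poly2 (\<lambda>z. p' (h z) * s' (h z) - q' (h z) * r' (h z))"
    by (rule poly2_diff[OF poly2_mult[OF pq'(1)[THEN poly2_comp, OF h] rs'(2)[THEN poly2_comp, OF h]]
          poly2_mult[OF pq'(2)[THEN poly2_comp, OF h] rs'(1)[THEN poly2_comp, OF h]]])
  ultimately have "\<exists>J. J \<noteq> 0 \<and> (\<forall>z. p z * s z - q z * r z = J)"
    by (rule poly2_unit_const[rotated 2])
  then obtain J where "J \<noteq> 0" "\<And>z. p z * s z - q z * r z = J"
    by blast
  with h1 h2 show ?thesis
    by (intro exI[of _ p] exI[of _ q] exI[of _ r] exI[of _ s] exI[of _ J] conjI allI)
qed

section \<open>Rational curves in the affine plane\<close>

text \<open>Regularity in the affine coordinate when infinity is removed from the curve: there is no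
  degree condition, and values on \<open>S\<close> are arbitrary.\<close>

definition rational_off :: "complex set \<Rightarrow> (complex \<Rightarrow> complex) \<Rightarrow> bool" where
  "rational_off S f \<longleftrightarrow> (\<exists>p q. q \<noteq> 0 \<and> (\<forall>t. t \<notin> S \<longrightarrow> poly q t \<noteq> 0 \<and> f t = poly p t / poly q t))"

lemma rational_off_poly: "rational_off S (poly p)"
  unfolding rational_off_def by (intro exI[of _ p] exI[of _ 1]) auto

lemma rational_off_add:
  assumes "rational_off S f" "rational_off S g"
  shows "rational_off S (\<lambda>t. f t + g t)"
proof -
  obtain p q where q: "q \<noteq> 0" and f: "\<And>t. t \<notin> S \<Longrightarrow> poly q t \<noteq> 0 \<and> f t = poly p t / poly q t"
    using assms(1) unfolding rational_off_def by blast
  obtain p' q' where q': "q' \<noteq> 0" and g: "\<And>t. t \<notin> S \<Longrightarrow> poly q' t \<noteq> 0 \<and> g t = poly p' t / poly q' t"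
    using assms(2) unfolding rational_off_def by blast
  have "poly (q * q') t \<noteq> 0 \<and> f t + g t = poly (p * q' + p' * q) t / poly (q * q') t" if "t \<notin> S" for t
    using f[OF that] g[OF that] by (simp add: add_frac_eq)
  moreover have "q * q' \<noteq> 0"
    using q q' by simp
  ultimately show ?thesis
    unfolding rational_off_def by blast
qed

lemma rational_off_mult:
  assumes "rational_off S f" "rational_off S g"
  shows "rational_off S (\<lambda>t. f t * g t)"
proof -
  obtain p q where q: "q \<noteq> 0" and f: "\<And>t. t \<notin> S \<Longrightarrow> poly q t \<noteq> 0 \<and> f t = poly p t / poly q t"
    using assms(1) unfolding rational_off_def by blast
  obtain p' q' where q': "q' \<noteq> 0" and g: "\<And>t. t \<notin> S \<Longrightarrow> poly q' t \<noteq> 0 \<and> g t = poly p' t / poly q' t"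
    using assms(2) unfolding rational_off_def by blast
  have "poly (q * q') t \<noteq> 0 \<and> f t * g t = poly (p * p') t / poly (q * q') t" if "t \<notin> S" for t
    using f[OF that] g[OF that] by (simp add: times_divide_times_eq)
  moreover have "q * q' \<noteq> 0"
    using q q' by simp
  ultimately show ?thesis
    unfolding rational_off_def by blast
qed

lemma rational_off_comp_poly:
  assumes "rational_off S X"
  shows "rational_off S (\<lambda>t. poly p (X t))"
proof (induction p)
  case 0
  show ?case using rational_off_poly[of S 0] by (simp add: rational_off_def)
next
  case (pCons a p)
  show ?case
    using rational_off_add[OF rational_off_poly[of S "[:a:]"] rational_off_mult[OF assms pCons.IH]]
    by simp
qed

lemma rational_off_comp_poly2:
  assumes "rational_off S X" "rational_off S Y" "poly2 F"
  shows "rational_off S (\<lambda>t. F (X t, Y t))"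
proof -
  obtain P where F: "F = bieval P"
    using assms(3) by (rule poly2E)
  have "rational_off S (\<lambda>t. bieval P (X t, Y t))"
  proof (induction P)
    case 0
    show ?case using rational_off_poly[of S 0] by (simp add: rational_off_def)
  next
    case (pCons p P)
    show ?case
      using rational_off_add[OF rational_off_comp_poly[OF assms(1), of p]
          rational_off_mult[OF assms(2) pCons.IH]] by simp
  qed
  then show ?thesis by (simp add: F)
qed

lemma rational_off_eq_0:
  assumes "rational_off S f" "infinite {t. t \<notin> S \<and> f t = 0}" "t \<notin> S"
  shows "f t = 0"
proof -
  obtain p q where pq: "\<And>t. t \<notin> S \<Longrightarrow> poly q t \<noteq> 0 \<and> f t = poly p t / poly q t"
    using assms(1) unfolding rational_off_def by blast
  have "{t. t \<notin> S \<and> f t = 0} \<subseteq> {t. poly p t = 0}"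
    using pq by auto
  then have "infinite {t. poly p t = 0}"
    using assms(2) by (rule infinite_super)
  then have "p = 0"
    using poly_roots_finite by blast
  then show ?thesis using pq[OF assms(3)] by simp
qed

lemma rational_off_differentiable:
  assumes "finite S" "rational_off S f" "t \<notin> S"
  obtains D where "(f has_field_derivative D) (at t)"
proof -
  obtain p q where pq: "\<And>t. t \<notin> S \<Longrightarrow> poly q t \<noteq> 0 \<and> f t = poly p t / poly q t"
    using assms(2) unfolding rational_off_def by blast
  have "((\<lambda>t. poly p t / poly q t) has_field_derivative
      (poly (pderiv p) t * poly q t - poly p t * poly (pderiv q) t) / (poly q t * poly q t)) (at t)"
    using pq[OF assms(3)] by (intro DERIV_divide poly_DERIV) auto
  then have "(f has_field_derivative
      (poly (pderiv p) t * poly q t - poly p t * poly (pderiv q) t) / (poly q t * poly q t)) (at t)"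
    using pq assms(3) finite_imp_closed[OF assms(1)]
    by (elim has_field_derivative_transform_within_open[where S = "- S"]) auto
  then show ?thesis by (rule that)
qed

text \<open>The numerator of \<open>f - f t0\<close> vanishes at \<open>t0\<close>; dividing it by
  \<open>t - t0\<close> keeps the denominator, so the divided difference is still regular off
  \<open>S\<close>.\<close>

lemma rational_off_factor:
  assumes "rational_off S f" "t0 \<notin> S"
  obtains e where "rational_off S e" "\<And>t. t \<notin> S \<Longrightarrow> f t - f t0 = (t - t0) * e t"
proof -
  obtain p q where "q \<noteq> 0" and pq: "\<And>t. t \<notin> S \<Longrightarrow> poly q t \<noteq> 0 \<and> f t = poly p t / poly q t"
    using assms(1) unfolding rational_off_def by blast
  have "poly (p - smult (f t0) q) t0 = 0"
    using pq[OF assms(2)] by simp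
  then obtain r where r: "p - smult (f t0) q = [:- t0, 1:] * r"
    by (metis poly_eq_0_iff_dvd dvdE)
  have "poly p t = f t0 * poly q t + (t - t0) * poly r t" for t
    using arg_cong[OF r, of "\<lambda>u. poly u t"] by (simp add: algebra_simps)
  then have "f t - f t0 = (t - t0) * (poly r t / poly q t)" if "t \<notin> S" for t
    using pq[OF that] by (simp add: field_simps)
  moreover have "rational_off S (\<lambda>t. poly r t / poly q t)"
    unfolding rational_off_def using \<open>q \<noteq> 0\<close> pq by blast
  ultimately show ?thesis using that by blast
qed

text \<open>The assumption \<open>generated\<close> is surjectivity of the comorphism:
  \<open>(X, Y)\<close> is a closed embedding of the affine line minus \<open>S\<close>.\<close>

locale affine_plane_curve =
  fixes S :: "complex set" and X Y :: "complex \<Rightarrow> complex"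
  assumes finite_S: "finite S"
    and rational_X: "rational_off S X" and rational_Y: "rational_off S Y"
    and generated: "rational_off S f \<Longrightarrow> \<exists>F. poly2 F \<and> (\<forall>t. t \<notin> S \<longrightarrow> f t = F (X t, Y t))"
begin

section \<open>The ideal of the curve, tangent vectors and conormals\<close>

definition vanishes :: "(complex \<times> complex \<Rightarrow> complex) \<Rightarrow> bool" where
  "vanishes F \<longleftrightarrow> (\<forall>t. t \<notin> S \<longrightarrow> F (X t, Y t) = 0)"

lemma infinite_compl: "infinite (- S)"
  using finite_S infinite_UNIV_char_0[where 'a = complex] by (simp add: Compl_eq_Diff_UNIV)

lemma open_compl: "open (- S)"
  using finite_imp_closed[OF finite_S] by (rule open_Compl)

lemma has_field_derivative_eq_off:
  assumes "(f has_field_derivative D) (at t)" "(g has_field_derivative E) (at t)"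
    and "t \<notin> S" "\<And>u. u \<notin> S \<Longrightarrow> f u = g u"
  shows "D = E"
proof -
  have "(g has_field_derivative D) (at t)"
    using assms open_compl
    by (elim has_field_derivative_transform_within_open[where S = "- S"]) auto
  then show ?thesis
    using assms(2) by (rule DERIV_unique)
qed

lemma identity_generated: "\<exists>T. poly2 T \<and> (\<forall>t. t \<notin> S \<longrightarrow> T (X t, Y t) = t)"
proof -
  obtain T where "poly2 T" "\<And>t. t \<notin> S \<Longrightarrow> poly [:0, 1:] t = T (X t, Y t)"
    using generated[OF rational_off_poly[of S "[:0, 1:]"]] by blast
  then show ?thesis by (intro exI[of _ T]) simp
qed

text \<open>Differentiating \<open>T (X t, Y t) = t\<close> gives
  \<open>a * D + b * E = 1\<close>.\<close>

lemma tangent_nonzero: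
  assumes "t \<notin> S" "(X has_field_derivative D) (at t)" "(Y has_field_derivative E) (at t)"
  shows "D \<noteq> 0 \<or> E \<noteq> 0"
proof -
  obtain T where T: "poly2 T" "\<And>t. t \<notin> S \<Longrightarrow> T (X t, Y t) = t"
    using identity_generated by blast
  obtain a b where "(T has_derivative (\<lambda>w. a * fst w + b * snd w)) (at (X t, Y t))"
    using poly2_has_derivative[OF T(1)] by blast
  then have "((\<lambda>t. T (X t, Y t)) has_field_derivative (a * D + b * E)) (at t)"
    using assms(2,3) by (rule has_derivative_linear_form_curve)
  from has_field_derivative_eq_off[OF this DERIV_ident assms(1) T(2)] have "a * D + b * E = 1" .
  then show ?thesis by auto
qed

lemma vanishes_tangent:
  assumes "t \<notin> S" "vanishes F"
    and "(F has_derivative (\<lambda>w. a * fst w + b * snd w)) (at (X t, Y t))"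
    and "(X has_field_derivative D) (at t)" "(Y has_field_derivative E) (at t)"
  shows "a * D + b * E = 0"
  using has_field_derivative_eq_off[OF has_derivative_linear_form_curve[OF assms(3-5)]
      DERIV_const[of 0] assms(1)] assms(2)
  by (simp add: vanishes_def)

text \<open>Writing \<open>X - X t = (u - t) e\<close> and \<open>Y - Y t = (u - t) f\<close> with \<open>e = E(X, Y)\<close> and
  \<open>f = F(X, Y)\<close>, the equation \<open>(y - Y t) E(x, y) = (x - X t) F(x, y)\<close> holds on the curve and has
  differential \<open>(- f t, e t)\<close> at the point of parameter \<open>t\<close>.\<close>
lemma vanishes_conormal_nonzero:
  assumes "t \<notin> S"
  shows "\<exists>G a b. poly2 G \<and> vanishes G \<and> (a \<noteq> 0 \<or> b \<noteq> 0) \<and>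
    (G has_derivative (\<lambda>w. a * fst w + b * snd w)) (at (X t, Y t))"
proof -
  obtain e where e: "rational_off S e" "\<And>u. u \<notin> S \<Longrightarrow> X u - X t = (u - t) * e u"
    using rational_off_factor[OF rational_X assms] by blast
  obtain f where f: "rational_off S f" "\<And>u. u \<notin> S \<Longrightarrow> Y u - Y t = (u - t) * f u"
    using rational_off_factor[OF rational_Y assms] by blast
  obtain E where E: "poly2 E" "\<And>t. t \<notin> S \<Longrightarrow> e t = E (X t, Y t)"
    using generated[OF e(1)] by blast
  obtain F where F: "poly2 F" "\<And>t. t \<notin> S \<Longrightarrow> f t = F (X t, Y t)"
    using generated[OF f(1)] by blast
  define G where "G = (\<lambda>z. (snd z - Y t) * E z - (fst z - X t) * F z)"
  have polyG: "poly2 G"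
    unfolding G_def using E(1) F(1)
    by (intro poly2_diff poly2_mult poly2_fst poly2_snd poly2_const)
  have vanG: "vanishes G"
    unfolding vanishes_def G_def using e(2) f(2) E(2) F(2) by (simp add: mult_ac)
  obtain E1 E2 where dE: "(E has_derivative (\<lambda>w. E1 * fst w + E2 * snd w)) (at (X t, Y t))"
    using poly2_has_derivative[OF E(1)] by blast
  obtain F1 F2 where dF: "(F has_derivative (\<lambda>w. F1 * fst w + F2 * snd w)) (at (X t, Y t))"
    using poly2_has_derivative[OF F(1)] by blast
  have dG: "(G has_derivative (\<lambda>w. (- f t) * fst w + e t * snd w)) (at (X t, Y t))"
    unfolding G_def
    by (rule derivative_eq_intros dE dF refl)+ (simp add: E(2) F(2) assms fun_eq_iff)
  \<comment> \<open>The product rule at \<open>u = t\<close>, where the factor \<open>u - t\<close>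
    vanishes, identifies \<open>e t\<close> and \<open>f t\<close> with the derivatives of
    \<open>X\<close> and \<open>Y\<close>, which are not both zero.\<close>
  have "- f t \<noteq> 0 \<or> e t \<noteq> 0"
  proof -
    have X': "(X has_field_derivative X') (at t) \<Longrightarrow> X' = e t"
      and Y': "(Y has_field_derivative Y') (at t) \<Longrightarrow> Y' = f t" for X' Y'
    proof -
      obtain e' where e': "(e has_field_derivative e') (at t)"
        using rational_off_differentiable[OF finite_S e(1) assms] .
      obtain f' where f': "(f has_field_derivative f') (at t)"
        using rational_off_differentiable[OF finite_S f(1) assms] .
      have 1: "((\<lambda>u. (u - t) * e u + X t) has_field_derivative e t) (at t)"
        by (rule derivative_eq_intros e' refl)+ simp
      have 2: "((\<lambda>u. (u - t) * f u + Y t) has_field_derivative f t) (at t)"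
        by (rule derivative_eq_intros f' refl)+ simp
      show "(X has_field_derivative X') (at t) \<Longrightarrow> X' = e t"
        using e(2) by (elim has_field_derivative_eq_off[OF _ 1 assms]) (metis diff_add_cancel)
      show "(Y has_field_derivative Y') (at t) \<Longrightarrow> Y' = f t"
        using f(2) by (elim has_field_derivative_eq_off[OF _ 2 assms]) (metis diff_add_cancel)
    qed
    obtain D where D: "(X has_field_derivative D) (at t)"
      using rational_off_differentiable[OF finite_S rational_X assms] .
    obtain D' where D': "(Y has_field_derivative D') (at t)"
      using rational_off_differentiable[OF finite_S rational_Y assms] .
    show ?thesis
      using tangent_nonzero[OF assms D D'] X'[OF D] Y'[OF D'] by auto
  qed
  with polyG vanG dG show ?thesis
    by (intro exI[of _ G] exI[of _ "- f t"] exI[of _ "e t"] conjI)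
qed

section \<open>The vanishing ideal is prime and principal\<close>

lemma vanishes_if_infinite:
  assumes "poly2 F" "infinite {t. t \<notin> S \<and> F (X t, Y t) = 0}"
  shows "vanishes F"
  unfolding vanishes_def
  using rational_off_eq_0[OF rational_off_comp_poly2[OF rational_X rational_Y assms(1)] assms(2)]
  by simp

text \<open>The ideal is prime: one factor vanishes at infinitely many parameters, hence at all of
  them.\<close>

lemma vanishes_mult_iff:
  assumes "poly2 F" "poly2 G"
  shows "vanishes (\<lambda>z. F z * G z) \<longleftrightarrow> vanishes F \<or> vanishes G"
proof
  assume "vanishes (\<lambda>z. F z * G z)"
  then have "- S \<subseteq> {t. t \<notin> S \<and> F (X t, Y t) = 0} \<union> {t. t \<notin> S \<and> G (X t, Y t) = 0}"
    by (auto simp: vanishes_def)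
  from infinite_super[OF this infinite_compl]
  have "infinite {t. t \<notin> S \<and> F (X t, Y t) = 0} \<or> infinite {t. t \<notin> S \<and> G (X t, Y t) = 0}"
    by simp
  then show "vanishes F \<or> vanishes G"
    using vanishes_if_infinite[OF assms(1)] vanishes_if_infinite[OF assms(2)] by blast
qed (auto simp: vanishes_def)

text \<open>Otherwise \<open>X\<close> takes finitely many values, is constant on an infinite set by
  the pigeonhole principle, and so is constant on the whole curve.\<close>

lemma poly_X_eq_0:
  assumes nonconst: "\<And>x. \<exists>t. t \<notin> S \<and> X t \<noteq> x" and "\<And>t. t \<notin> S \<Longrightarrow> poly p (X t) = 0"
  shows "p = 0"
proof (rule ccontr)
  assume "p \<noteq> 0"
  have "X ` (- S) \<subseteq> {x. poly p x = 0}"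
    using assms(2) by auto
  then have "finite (X ` (- S))"
    using poly_roots_finite[OF \<open>p \<noteq> 0\<close>] by (rule finite_subset)
  from pigeonhole_infinite[OF infinite_compl this]
  obtain t0 where inf: "infinite {t \<in> - S. X t = X t0}"
    by blast
  have "poly2 (\<lambda>z. fst z - X t0)"
    by (intro poly2_diff poly2_fst poly2_const)
  moreover have "{t. t \<notin> S \<and> fst (X t, Y t) - X t0 = 0} = {t \<in> - S. X t = X t0}"
    by auto
  ultimately have "vanishes (\<lambda>z. fst z - X t0)"
    using inf by (intro vanishes_if_infinite) simp_all
  with nonconst[of "X t0"] show False
    by (auto simp: vanishes_def)
qed

text \<open>The generator is the primitive part of an element of least degree in \<open>y\<close>.
  For a vertical line this would fail: the ideal then contains a polynomial in \<open>x\<close>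
  alone, whose primitive part is a unit; hence \<open>nonconst\<close>.\<close>

lemma vanishing_ideal_principal_aux:
  assumes nonconst: "\<And>x. \<exists>t. t \<notin> S \<and> X t \<noteq> x"
  shows "\<exists>F. F \<noteq> 0 \<and> vanishes (bieval F) \<and> (\<forall>G. vanishes (bieval G) \<longrightarrow> F dvd G)"
proof -
  obtain t where "t \<notin> S"
    using nonconst by blast
  then obtain G0 a b where G0: "poly2 G0" "vanishes G0" and ab: "a \<noteq> 0 \<or> b \<noteq> 0"
    and dG0: "(G0 has_derivative (\<lambda>w. a * fst w + b * snd w)) (at (X t, Y t))"
    using vanishes_conormal_nonzero[of t] by blast
  obtain P0 where P0: "G0 = bieval P0"
    using G0(1) by (rule poly2E)
  \<comment> \<open>An element with non-zero differential shows that the ideal is not zero, so a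
    minimum exists.\<close>
  have "P0 \<noteq> 0"
  proof
    assume "P0 = 0"
    then have "G0 = (\<lambda>z. 0)"
      by (simp add: P0 fun_eq_iff)
    then have "(G0 has_derivative (\<lambda>w. 0 * fst w + 0 * snd w)) (at (X t, Y t))"
      by simp
    from has_derivative_linear_form_unique[OF dG0 this] ab show False by simp
  qed
  define F0 where "F0 = arg_min degree (\<lambda>P. P \<noteq> 0 \<and> vanishes (bieval P))"
  have F0: "F0 \<noteq> 0" "vanishes (bieval F0)"
    using arg_min_natI[of "\<lambda>P. P \<noteq> 0 \<and> vanishes (bieval P)" P0 degree] \<open>P0 \<noteq> 0\<close> G0(2)
    unfolding F0_def P0 by simp_all
  have F0_min: "degree F0 \<le> degree P" if "P \<noteq> 0" "vanishes (bieval P)" for P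
    unfolding F0_def using that by (intro arg_min_nat_le conjI)
  define F where "F = primitive_part F0"
  have F: "F \<noteq> 0" "content F = 1" "degree F = degree F0"
    using F0(1) by (simp_all add: F_def)
  have "bieval F0 = (\<lambda>z. bieval [:content F0:] z * bieval F z)"
    using arg_cong[OF content_times_primitive_part[of F0], of bieval]
    by (simp add: F_def fun_eq_iff del: content_times_primitive_part)
  with F0(2) have "vanishes (\<lambda>z. bieval [:content F0:] z * bieval F z)"
    by (simp only:)
  then have "vanishes (bieval [:content F0:]) \<or> vanishes (bieval F)"
    by (simp only: vanishes_mult_iff[OF poly2_bieval poly2_bieval])
  \<comment> \<open>The content is a polynomial in \<open>x\<close> alone, so by primality it is the
    primitive part that vanishes on the curve.\<close>
  moreover have "\<not> vanishes (bieval [:content F0:])"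
  proof
    assume "vanishes (bieval [:content F0:])"
    then have "poly (content F0) (X t) = 0" if "t \<notin> S" for t
      using that by (simp add: vanishes_def)
    from poly_X_eq_0[OF nonconst this] F0(1) show False by simp
  qed
  ultimately have vanF: "vanishes (bieval F)" by simp
  have "F dvd G" if G: "vanishes (bieval G)" for G
  proof -
    \<comment> \<open>The pseudo-remainder lies in the ideal and has smaller degree in
      \<open>y\<close> than \<open>F\<close>, so it is zero by minimality.\<close>
    obtain a Q where a: "a \<noteq> 0" and eq: "smult a G = F * Q + pseudo_mod G F"
      using pseudo_mod(1)[OF F(1), of G] by blast
    have "bieval (pseudo_mod G F) z = poly a (fst z) * bieval G z - bieval F z * bieval Q z" for z
      using arg_cong[OF eq, of "\<lambda>P. bieval P z"] by simp
    then have "vanishes (bieval (pseudo_mod G F))"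
      using G vanF by (simp add: vanishes_def)
    then have "pseudo_mod G F = 0"
      using F0_min[of "pseudo_mod G F"] pseudo_mod(2)[OF F(1), of G] F(3) leD by metis
    then have "F dvd smult a G"
      using eq by simp
    with F(2) show ?thesis
      using a by (rule primitive_dvd_smult)
  qed
  with F(1) vanF show ?thesis by blast
qed

lemma swap_curve: "affine_plane_curve S Y X"
proof
  show "\<exists>F. poly2 F \<and> (\<forall>t. t \<notin> S \<longrightarrow> f t = F (Y t, X t))" if f: "rational_off S f" for f
  proof -
    obtain F where "poly2 F" "\<And>t. t \<notin> S \<Longrightarrow> f t = F (X t, Y t)"
      using generated[OF f] by blast
    then show ?thesis
      by (intro exI[of _ "\<lambda>z. F (prod.swap z)"]) (simp add: poly2_comp[OF _ poly2_map_swap])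
  qed
qed (fact finite_S rational_X rational_Y)+

lemma vanishing_ideal_principal:
  "\<exists>F. poly2 F \<and> vanishes F \<and>
    (\<forall>G. poly2 G \<longrightarrow> vanishes G \<longrightarrow> (\<exists>Q. poly2 Q \<and> (\<forall>z. G z = F z * Q z)))"
proof (cases "\<forall>x. \<exists>t. t \<notin> S \<and> X t \<noteq> x")
  case True
  from vanishing_ideal_principal_aux[OF True[rule_format]]
  obtain P where P: "vanishes (bieval P)" "\<forall>G. vanishes (bieval G) \<longrightarrow> P dvd G"
    by (elim exE conjE)
  have "\<exists>Q. poly2 Q \<and> (\<forall>z. G z = bieval P z * Q z)" if G: "poly2 G" "vanishes G" for G
  proof -
    obtain R where R: "G = bieval R"
      using G(1) by (rule poly2E)
    then have "P dvd R"
      using P(2) G(2) by simp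
    then obtain Q where "R = P * Q" ..
    then show ?thesis
      by (intro exI[of _ "bieval Q"]) (simp add: R)
  qed
  with P(1) show ?thesis
    by (intro exI[of _ "bieval P"]) (simp add: poly2_bieval)
next
  case False
  then obtain x where x: "\<And>t. t \<notin> S \<Longrightarrow> X t = x" by blast
  interpret swap: affine_plane_curve S Y X
    by (rule swap_curve)
  have vanishes_swap: "swap.vanishes (\<lambda>z. F (prod.swap z)) \<longleftrightarrow> vanishes F" for F
    by (simp add: vanishes_def swap.vanishes_def)
  \<comment> \<open>With \<open>X\<close> constant, a constant \<open>Y\<close> would put the whole
    curve at one point, from which \<open>T\<close> could not recover infinitely many parameters. So
    exchanging the coordinates reduces to the first case.\<close>
  have nonconst: "\<exists>t. t \<notin> S \<and> Y t \<noteq> y" for y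
  proof (rule ccontr)
    assume "\<not> ?thesis"
    then have y: "\<And>t. t \<notin> S \<Longrightarrow> Y t = y" by blast
    from identity_generated obtain T where T: "\<forall>t. t \<notin> S \<longrightarrow> T (X t, Y t) = t"
      by (elim exE conjE)
    have "T (x, y) = t" if "t \<notin> S" for t
      using T[rule_format, OF that] by (simp only: x[OF that] y[OF that])
    then have "- S \<subseteq> {T (x, y)}"
      by blast
    from infinite_super[OF this infinite_compl] show False
      by simp
  qed
  from swap.vanishing_ideal_principal_aux[OF nonconst]
  obtain P where P: "swap.vanishes (bieval P)" "\<forall>G. swap.vanishes (bieval G) \<longrightarrow> P dvd G"
    by (elim exE conjE)
  define F where "F = (\<lambda>z. bieval P (prod.swap z))"
  have "poly2 F"
    unfolding F_def by (rule poly2_comp[OF poly2_bieval poly2_map_swap])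
  moreover have "vanishes F"
    using P(1) vanishes_swap[of F] by (simp add: F_def)
  moreover have "\<exists>Q. poly2 Q \<and> (\<forall>z. G z = F z * Q z)" if G: "poly2 G" "vanishes G" for G
  proof -
    obtain R where R: "(\<lambda>z. G (prod.swap z)) = bieval R"
      using poly2_comp[OF G(1) poly2_map_swap] by (rule poly2E)
    have "swap.vanishes (bieval R)"
      using G(2) vanishes_swap[of G] by (simp add: R)
    then have "P dvd R"
      using P(2) by blast
    then obtain Q where Q: "R = P * Q" ..
    have "G z = F z * bieval Q (prod.swap z)" for z
      using fun_cong[OF R, of "prod.swap z"] by (simp add: Q F_def)
    then show ?thesis
      using poly2_comp[OF poly2_bieval poly2_map_swap] by (intro exI conjI allI)
  qed
  ultimately show ?thesis
    by (intro exI[of _ F]) simp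
qed

text \<open>Both \<open>F o h\<close> and \<open>F o k\<close> lie in the ideal generated by
  \<open>F\<close>; comparing the cofactors shows that \<open>Q\<close> is a unit, hence
  constant.\<close>

lemma equation_semi_invariant:
  assumes h: "aut_A2 h" and \<gamma>: "\<gamma> ` (- S) = - S"
    and equiv: "\<And>t. t \<notin> S \<Longrightarrow> h (X t, Y t) = (X (\<gamma> t), Y (\<gamma> t))"
    and F: "poly2 F" "vanishes F" "\<not> (\<forall>z. F z = 0)"
    and gen: "\<And>G. poly2 G \<Longrightarrow> vanishes G \<Longrightarrow> \<exists>Q. poly2 Q \<and> (\<forall>z. G z = F z * Q z)"
  shows "\<exists>c. \<forall>z. F (h z) = c * F z"
proof -
  obtain k where ph: "poly_map2 h" and pk: "poly_map2 k"
    and hk: "\<And>z. h (k z) = z" and kh: "\<And>z. k (h z) = z"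
    using h by (auto simp: aut_A2_def fun_eq_iff)
  have "vanishes (\<lambda>z. F (h z))"
    using F(2) \<gamma> equiv by (auto simp: vanishes_def)
  then obtain Q where Q: "poly2 Q" "\<And>z. F (h z) = F z * Q z"
    using gen[OF poly2_comp[OF F(1) ph]] by blast
  \<comment> \<open>Here surjectivity of \<open>\<gamma>\<close> matters: \<open>k\<close> maps the
    point of parameter \<open>\<gamma> u\<close> back to that of parameter \<open>u\<close>.\<close>
  have "F (k (X t, Y t)) = 0" if "t \<notin> S" for t
  proof -
    have "t \<in> \<gamma> ` (- S)"
      using that \<gamma> by simp
    then obtain u where "u \<notin> S" "t = \<gamma> u" by blast
    then show ?thesis
      using equiv[of u] kh[of "(X u, Y u)"] F(2) by (simp add: vanishes_def)
  qed
  then have "vanishes (\<lambda>z. F (k z))"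
    by (simp add: vanishes_def)
  then obtain R where R: "poly2 R" "\<And>z. F (k z) = F z * R z"
    using gen[OF poly2_comp[OF F(1) pk]] by blast
  have "F z * (Q z * R (h z) - 1) = 0" for z
    using R(2)[of "h z"] Q(2)[of z] by (simp add: kh algebra_simps)
  moreover have polyRh: "poly2 (\<lambda>z. R (h z))"
    using R(1) ph by (rule poly2_comp)
  moreover have "poly2 (\<lambda>z. Q z * R (h z) - 1)"
    by (rule poly2_diff[OF poly2_mult[OF Q(1) polyRh] poly2_const])
  ultimately have "(\<forall>z. F z = 0) \<or> (\<forall>z. Q z * R (h z) - 1 = 0)"
    by (intro poly2_mult_eq_0[OF F(1)])
  with F(3) have "\<forall>z. Q z * R (h z) - 1 = 0"
    by blast
  then have "Q z * R (h z) = 1" for z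
    by (simp only: right_minus_eq)
  from poly2_unit_const[OF Q(1) polyRh this] obtain c where c: "\<And>z. Q z = c"
    by blast
  have "F (h z) = c * F z" for z
    using Q(2)[of z] c[of z] by simp
  then show ?thesis by blast
qed

text \<open>At a fixed point, the Jacobian of \<open>h\<close> is the product of the tangential eigenvalue, which is
  the multiplier of \<open>\<gamma>\<close>, and the conormal eigenvalue. The latter is the constant \<open>c\<close> with
  \<open>F \<circ> h = c F\<close> for an equation \<open>F\<close> of the curve, and the Jacobian is constant too.\<close>
lemma fixed_point_multipliers_eq:
  assumes h: "aut_A2 h" and \<gamma>: "\<gamma> ` (- S) = - S"
    and equiv: "\<And>t. t \<notin> S \<Longrightarrow> h (X t, Y t) = (X (\<gamma> t), Y (\<gamma> t))"
    and "t1 \<notin> S" "\<gamma> t1 = t1" "(\<gamma> has_field_derivative l1) (at t1)"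
    and "t2 \<notin> S" "\<gamma> t2 = t2" "(\<gamma> has_field_derivative l2) (at t2)"
  shows "l1 = l2"
proof -
  obtain p q r s J where
      h1: "\<And>z. ((\<lambda>z. fst (h z)) has_derivative (\<lambda>w. p z * fst w + q z * snd w)) (at z)"
    and h2: "\<And>z. ((\<lambda>z. snd (h z)) has_derivative (\<lambda>w. r z * fst w + s z * snd w)) (at z)"
    and J: "\<And>z. p z * s z - q z * r z = J" and "J \<noteq> 0"
    using aut_A2_jacobian_const[OF h] by blast
  obtain F where F: "poly2 F" "vanishes F"
    and gen: "\<And>G. poly2 G \<Longrightarrow> vanishes G \<Longrightarrow> \<exists>Q. poly2 Q \<and> (\<forall>z. G z = F z * Q z)"
    using vanishing_ideal_principal by blast
  obtain a b where dF: "\<And>z. (F has_derivative (\<lambda>w. a z * fst w + b z * snd w)) (at z)"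
    using poly2_has_derivative[OF F(1)] by blast
  \<comment> \<open>If \<open>dF\<close> vanished at a point of the curve, so would
    \<open>dG = Q dF + F dQ\<close> for every \<open>G = F Q\<close> in the ideal.\<close>
  have conormal: "a (X t, Y t) \<noteq> 0 \<or> b (X t, Y t) \<noteq> 0" if t: "t \<notin> S" for t
  proof (rule ccontr)
    assume ab: "\<not> ?thesis"
    obtain G a' b' where G: "poly2 G" "vanishes G" and ab': "a' \<noteq> 0 \<or> b' \<noteq> 0"
      and dG: "(G has_derivative (\<lambda>w. a' * fst w + b' * snd w)) (at (X t, Y t))"
      using vanishes_conormal_nonzero[OF t] by blast
    obtain Q where Q: "poly2 Q" "\<And>z. G z = F z * Q z"
      using gen[OF G] by blast
    obtain Q1 Q2 where dQ: "(Q has_derivative (\<lambda>w. Q1 * fst w + Q2 * snd w)) (at (X t, Y t))"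
      using poly2_has_derivative[OF Q(1)] by blast
    have "((\<lambda>z. F z * Q z) has_derivative (\<lambda>w. 0 * fst w + 0 * snd w)) (at (X t, Y t))"
      by (rule derivative_eq_intros dF dQ refl)+
        (use ab F(2) t in \<open>simp add: vanishes_def fun_eq_iff\<close>)
    moreover have "(\<lambda>z. F z * Q z) = G"
      by (rule ext) (rule Q(2)[symmetric])
    ultimately have "(G has_derivative (\<lambda>w. 0 * fst w + 0 * snd w)) (at (X t, Y t))"
      by (simp only:)
    from has_derivative_linear_form_unique[OF dG this] ab' show False
      by simp
  qed
  have nonzero: "\<not> (\<forall>z. F z = 0)"
  proof
    assume "\<forall>z. F z = 0"
    then have "F = (\<lambda>z. 0)" by (simp add: fun_eq_iff)
    then have "(F has_derivative (\<lambda>w. 0 * fst w + 0 * snd w)) (at z)" for z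
      by simp
    then show False
      using has_derivative_linear_form_unique[OF dF] conormal[OF assms(4)] by metis
  qed
  obtain c where c: "\<And>z. F (h z) = c * F z"
    using equation_semi_invariant[OF h \<gamma> equiv F nonzero gen] by blast
  have det: "J = c * l" if t: "t \<notin> S" "\<gamma> t = t" "(\<gamma> has_field_derivative l) (at t)" for t l
  proof -
    define z where "z = (X t, Y t)"
    have hz: "h z = z"
      using equiv[OF t(1)] t(2) by (simp add: z_def)
    obtain D where D: "(X has_field_derivative D) (at t)"
      using rational_off_differentiable[OF finite_S rational_X t(1)] .
    obtain E where E: "(Y has_field_derivative E) (at t)"
      using rational_off_differentiable[OF finite_S rational_Y t(1)] .
    have X\<gamma>: "((\<lambda>u. X (\<gamma> u)) has_field_derivative D * l) (at t)"
      and Y\<gamma>: "((\<lambda>u. Y (\<gamma> u)) has_field_derivative E * l) (at t)"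
      using DERIV_chain2[OF _ t(3), of X D] DERIV_chain2[OF _ t(3), of Y E] D E t(2) by simp_all
    \<comment> \<open>Facts 1 and 2 make \<open>(D, E)\<close> an eigenvector of the Jacobian matrix
      for \<open>l\<close>; 3 and 4 make \<open>(a z, b z)\<close> a left eigenvector for
      \<open>c\<close>; 5 says that the two are orthogonal.\<close>
    have 1: "p z * D + q z * E = D * l"
      using has_derivative_linear_form_curve[OF h1 D E] X\<gamma> t(1)
      unfolding z_def by (rule has_field_derivative_eq_off) (simp add: equiv)
    have 2: "r z * D + s z * E = E * l"
      using has_derivative_linear_form_curve[OF h2 D E] Y\<gamma> t(1)
      unfolding z_def by (rule has_field_derivative_eq_off) (simp add: equiv)
    have "((\<lambda>z. F (h z)) has_derivative
        (\<lambda>w. (a z * p z + b z * r z) * fst w + (a z * q z + b z * s z) * snd w)) (at z)"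
      using has_derivative_linear_form_compose[OF dF h1 h2, of z] by (simp add: hz)
    moreover have "((\<lambda>z. F (h z)) has_derivative (\<lambda>w. (c * a z) * fst w + (c * b z) * snd w)) (at z)"
      using has_derivative_mult_right[OF dF, of c] by (simp add: c algebra_simps)
    ultimately have 3: "a z * p z + b z * r z = c * a z" and 4: "a z * q z + b z * s z = c * b z"
      by (rule has_derivative_linear_form_unique)+
    have 5: "a z * D + b z * E = 0"
      using vanishes_tangent[OF t(1) F(2) dF D E] by (simp add: z_def)
    have ab: "a z \<noteq> 0 \<or> b z \<noteq> 0"
      using conormal[OF t(1)] by (simp add: z_def)
    have DE: "D \<noteq> 0 \<or> E \<noteq> 0"
      using tangent_nonzero[OF t(1) D E] .
    \<comment> \<open>The determinant is \<open>c * l\<close>, stated without division; by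
      orthogonality of two non-zero vectors, one of the multipliers \<open>D * b z\<close> and
      \<open>E * a z\<close> is non-zero.\<close>
    have "D * b z * (p z * s z - q z * r z - c * l) = 0" "E * a z * (p z * s z - q z * r z - c * l) = 0"
      using 1 2 3 4 5 by algebra+
    moreover have "D * b z \<noteq> 0 \<or> E * a z \<noteq> 0"
      using ab DE 5 by auto
    ultimately show ?thesis
      using J[of z] by auto
  qed
  \<comment> \<open>\<open>J = c * l1 = c * l2\<close>, and \<open>c\<close> cancels because
    \<open>J\<close> is non-zero.\<close>
  show ?thesis
    using det[OF assms(4-6)] det[OF assms(7-9)] \<open>J \<noteq> 0\<close> by auto
qed

end

section \<open>Moebius transformations\<close>

text \<open>Homogeneous coordinates turn \<open>moeb\<close> into a linear map without case
  distinctions. The pair \<open>(0, 0)\<close> yields the dummy value \<open>Inf\<close>, so later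
  lemmas exclude it.\<close>

definition proj_pt :: "complex \<Rightarrow> complex \<Rightarrow> p1" where
  "proj_pt x y = (if y = 0 then Inf else Fin (x / y))"

lemma proj_pt_cases:
  obtains x y where "z = proj_pt x y" "x \<noteq> 0 \<or> y \<noteq> 0"
proof (cases z)
  case (Fin t)
  then show ?thesis using that[of t 1] by (simp add: proj_pt_def)
next
  case Inf
  then show ?thesis using that[of 1 0] by (simp add: proj_pt_def)
qed

lemma proj_pt_scale: "k \<noteq> 0 \<Longrightarrow> proj_pt (k * x) (k * y) = proj_pt x y"
  by (simp add: proj_pt_def)

lemma moeb_Fin: "moeb a b c d (Fin z) = proj_pt (a * z + b) (c * z + d)"
  and moeb_Inf: "moeb a b c d Inf = proj_pt a c"
  by (simp_all add: proj_pt_def)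

lemma moeb_proj_pt:
  assumes "x \<noteq> 0 \<or> y \<noteq> 0"
  shows "moeb a b c d (proj_pt x y) = proj_pt (a * x + b * y) (c * x + d * y)"
proof (cases "y = 0")
  case True
  then show ?thesis
    using assms by (simp add: moeb_Inf proj_pt_def)
next
  case False
  then have "moeb a b c d (proj_pt x y) = proj_pt (y * (a * (x / y) + b)) (y * (c * (x / y) + d))"
    by (subst proj_pt_scale) (simp_all add: proj_pt_def)
  moreover have "y * (a * (x / y) + b) = a * x + b * y" "y * (c * (x / y) + d) = c * x + d * y"
    using False by (simp_all add: distrib_left)
  ultimately show ?thesis by simp
qed

lemma linear_map_nonzero:
  fixes a b c d x y :: complex
  assumes "a * d - b * c \<noteq> 0" "x \<noteq> 0 \<or> y \<noteq> 0"
  shows "a * x + b * y \<noteq> 0 \<or> c * x + d * y \<noteq> 0"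
proof (rule ccontr)
  assume "\<not> ?thesis"
  then have "(a * d - b * c) * x = 0" "(a * d - b * c) * y = 0"
    by algebra+
  then show False using assms by simp
qed

definition moebius :: "(p1 \<Rightarrow> p1) \<Rightarrow> bool" where
  "moebius m \<longleftrightarrow> (\<exists>a b c d. a * d - b * c \<noteq> 0 \<and> m = moeb a b c d)"

lemma curve_aut_iff: "curve_aut \<Lambda> g \<longleftrightarrow> moebius g \<and> g ` \<Lambda> = \<Lambda>"
  unfolding curve_aut_def moebius_def by blast

lemma moebius_comp:
  assumes "moebius m" "moebius n"
  shows "moebius (m \<circ> n)"
proof -
  obtain a b c d where m: "a * d - b * c \<noteq> 0" "m = moeb a b c d"
    using assms(1) by (auto simp: moebius_def)
  obtain a' b' c' d' where n: "a' * d' - b' * c' \<noteq> 0" "n = moeb a' b' c' d'"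
    using assms(2) by (auto simp: moebius_def)
  have "m (n z) = moeb (a * a' + b * c') (a * b' + b * d') (c * a' + d * c') (c * b' + d * d') z" for z
  proof -
    obtain x y where z: "z = proj_pt x y" "x \<noteq> 0 \<or> y \<noteq> 0"
      by (rule proj_pt_cases)
    then show ?thesis
      using linear_map_nonzero[OF n(1) z(2)] by (simp add: m(2) n(2) moeb_proj_pt algebra_simps)
  qed
  then have "m \<circ> n = moeb (a * a' + b * c') (a * b' + b * d') (c * a' + d * c') (c * b' + d * d')"
    by (simp add: fun_eq_iff)
  moreover have "(a * a' + b * c') * (c * b' + d * d') - (a * b' + b * d') * (c * a' + d * c')
      = (a * d - b * c) * (a' * d' - b' * c')"
    by (simp add: algebra_simps)
  ultimately show ?thesis
    using m(1) n(1) unfolding moebius_def by (metis no_zero_divisors)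
qed

lemma moebius_inverse:
  assumes "moebius m"
  obtains n where "moebius n" "\<And>z. m (n z) = z" "\<And>z. n (m z) = z"
proof -
  obtain a b c d where m: "a * d - b * c \<noteq> 0" "m = moeb a b c d"
    using assms by (auto simp: moebius_def)
  \<comment> \<open>The adjugate matrix: both compositions scale the homogeneous coordinates by the
    determinant.\<close>
  define n where "n = moeb d (- b) (- c) a"
  have det: "d * a - (- b) * (- c) \<noteq> 0"
    using m(1) by (simp add: mult.commute)
  have "m (n z) = z \<and> n (m z) = z" for z
  proof -
    obtain x y where z: "z = proj_pt x y" "x \<noteq> 0 \<or> y \<noteq> 0"
      by (rule proj_pt_cases)
    have "m (n z) = proj_pt ((a * d - b * c) * x) ((a * d - b * c) * y)"
      using linear_map_nonzero[OF det z(2)] z by (simp add: m(2) n_def moeb_proj_pt algebra_simps)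
    moreover have "n (m z) = proj_pt ((a * d - b * c) * x) ((a * d - b * c) * y)"
      using linear_map_nonzero[OF m(1) z(2)] z by (simp add: m(2) n_def moeb_proj_pt algebra_simps)
    ultimately show ?thesis
      using z(1) by (simp add: proj_pt_scale[OF m(1)])
  qed
  moreover have "moebius n"
    unfolding moebius_def n_def using det by blast
  ultimately show ?thesis using that by blast
qed

text \<open>For a finite target \<open>a\<close> the witness is
  \<open>t |-> a + 1 / t\<close>.\<close>

lemma moebius_from_Inf:
  obtains m where "moebius m" "m Inf = p"
proof (cases p)
  case (Fin a)
  have "moebius (moeb a 1 1 0)"
    unfolding moebius_def by (intro exI[of _ a] exI[of _ 1] exI[of _ 0] conjI) auto
  with that Fin show ?thesis by simp
next
  case Inf
  have "moebius (moeb 1 0 0 1)"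
    unfolding moebius_def by (intro exI[of _ 1] exI[of _ 0] conjI) auto
  with that Inf show ?thesis by simp
qed

text \<open>Binary forms give a chart-free description of regular functions: they are quotients of two
  forms of the same degree, evaluated at homogeneous coordinates.\<close>
definition binary_form :: "nat \<Rightarrow> complex poly \<Rightarrow> complex \<Rightarrow> complex \<Rightarrow> complex" where
  "binary_form N p x y = (\<Sum>i\<le>N. coeff p i * x ^ i * y ^ (N - i))"

lemma binary_form_0_right: "binary_form N p x 0 = coeff p N * x ^ N"
proof -
  have "binary_form N p x 0 = (\<Sum>i\<in>{N}. coeff p i * x ^ i * 0 ^ (N - i))"
    unfolding binary_form_def by (rule sum.mono_neutral_right) auto
  then show ?thesis by simp
qed

lemma binary_form_eq_poly:
  assumes "y \<noteq> 0" "degree p \<le> N"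
  shows "binary_form N p x y = y ^ N * poly p (x / y)"
proof -
  have "poly p (x / y) = (\<Sum>i\<le>N. coeff p i * (x / y) ^ i)"
    using assms(2) by (simp add: poly_altdef coeff_eq_0 sum.mono_neutral_left)
  moreover have "coeff p i * x ^ i * y ^ (N - i) = y ^ N * (coeff p i * (x / y) ^ i)" if "i \<le> N" for i
    using assms(1) that by (simp add: power_divide power_diff)
  ultimately show ?thesis
    unfolding binary_form_def by (simp only: sum_distrib_left) (auto intro!: sum.cong)
qed

lemma coeff_mult_top:
  assumes "degree p \<le> m" "degree q \<le> n"
  shows "coeff (p * q) (m + n) = coeff p m * coeff q n"
proof (cases "degree p = m \<and> degree q = n")
  case True
  then show ?thesis by (auto simp: coeff_mult_degree_sum)
next
  case False
  then have "degree p + degree q < m + n" and "coeff p m * coeff q n = 0"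
    using assms by (auto simp: coeff_eq_0)
  then show ?thesis
    using degree_mult_le[of p q] by (simp add: coeff_eq_0)
qed

lemma degree_linear_power_le: "degree ([:b, a:] ^ n) \<le> n"
  using degree_power_le[of "[:b, a:]" n] by (simp split: if_splits)

lemma coeff_linear_power_top: "coeff ([:b, a:] ^ n) n = a ^ n"
proof (induction n)
  case (Suc n)
  have "coeff ([:b, a:] * [:b, a:] ^ n) (1 + n) = coeff [:b, a:] 1 * coeff ([:b, a:] ^ n) n"
    by (rule coeff_mult_top) (simp_all add: degree_linear_power_le)
  then show ?case by (simp add: Suc.IH)
qed simp

text \<open>The degree \<open>N\<close> form of \<open>p\<close> after the substitution
  \<open>x = a t + b\<close>, \<open>y = c t + d\<close>. Its degree in \<open>t\<close> may drop
  below \<open>N\<close>, so the value at infinity is the coefficient at \<open>N\<close>, not the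
  leading one.\<close>

definition form_pullback :: "nat \<Rightarrow> complex poly \<Rightarrow> complex \<Rightarrow> complex \<Rightarrow> complex \<Rightarrow> complex \<Rightarrow> complex poly"
  where "form_pullback N p a b c d = (\<Sum>i\<le>N. smult (coeff p i) ([:b, a:] ^ i * [:d, c:] ^ (N - i)))"

lemma poly_form_pullback:
  "poly (form_pullback N p a b c d) z = binary_form N p (a * z + b) (c * z + d)"
  by (simp add: form_pullback_def binary_form_def poly_sum algebra_simps)

lemma degree_form_pullback_le: "degree (form_pullback N p a b c d) \<le> N"
  unfolding form_pullback_def
proof (intro degree_sum_le)
  fix i assume "i \<in> {..N}"
  have "degree ([:b, a:] ^ i * [:d, c:] ^ (N - i)) \<le> i + (N - i)"
    using degree_mult_le add_mono[OF degree_linear_power_le degree_linear_power_le] by (rule order_trans)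
  then show "degree (smult (coeff p i) ([:b, a:] ^ i * [:d, c:] ^ (N - i))) \<le> N"
    using \<open>i \<in> {..N}\<close> degree_smult_le[of "coeff p i" "[:b, a:] ^ i * [:d, c:] ^ (N - i)"] by simp
qed simp

lemma coeff_form_pullback_top: "coeff (form_pullback N p a b c d) N = binary_form N p a c"
proof -
  have "coeff ([:b, a:] ^ i * [:d, c:] ^ (N - i)) N = a ^ i * c ^ (N - i)" if "i \<le> N" for i
    using coeff_mult_top[OF degree_linear_power_le degree_linear_power_le, of b a i d c "N - i"] that
    by (simp add: coeff_linear_power_top)
  then show ?thesis
    by (simp add: form_pullback_def binary_form_def coeff_sum mult_ac)
qed

text \<open>Homogenising \<open>p\<close> and \<open>q\<close> to the same degree makes the quotient
  independent of scaling. If infinity is on the curve, then \<open>N = degree q\<close>, so the form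
  of \<open>q\<close> does not vanish there.\<close>

lemma regular_on_binary_form:
  assumes "q \<noteq> 0"
    and Fin: "\<And>z. Fin z \<in> \<Gamma> \<Longrightarrow> poly q z \<noteq> 0 \<and> f (Fin z) = poly p z / poly q z"
    and Inf: "Inf \<in> \<Gamma> \<Longrightarrow> degree p \<le> degree q \<and>
          f Inf = (if degree p = degree q then lead_coeff p / lead_coeff q else 0)"
    and N: "N = max (degree p) (degree q)"
    and pt: "proj_pt x y \<in> \<Gamma>" "x \<noteq> 0 \<or> y \<noteq> 0"
  shows "binary_form N q x y \<noteq> 0 \<and> f (proj_pt x y) = binary_form N p x y / binary_form N q x y"
proof (cases "y = 0")
  case True
  then have "x \<noteq> 0" "Inf \<in> \<Gamma>"
    using pt by (auto simp: proj_pt_def)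
  from Inf[OF this(2)] have "N = degree q"
    and "f Inf = (if degree p = degree q then lead_coeff p / lead_coeff q else 0)" "degree p \<le> degree q"
    using N by auto
  then show ?thesis
    using True \<open>x \<noteq> 0\<close> \<open>q \<noteq> 0\<close> by (auto simp: binary_form_0_right proj_pt_def coeff_eq_0)
next
  case False
  then have "Fin (x / y) \<in> \<Gamma>"
    using pt by (simp add: proj_pt_def)
  from Fin[OF this] show ?thesis
    using False by (simp add: binary_form_eq_poly N proj_pt_def)
qed

lemma regular_on_moebius:
  assumes "regular_on \<Gamma> f" "moebius m"
  shows "regular_on (m -` \<Gamma>) (f \<circ> m)"
proof -
  obtain a b c d where det: "a * d - b * c \<noteq> 0" and m: "m = moeb a b c d"
    using assms(2) by (auto simp: moebius_def)
  obtain p q where q: "q \<noteq> 0"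
    and Fin: "\<And>z. Fin z \<in> \<Gamma> \<Longrightarrow> poly q z \<noteq> 0 \<and> f (Fin z) = poly p z / poly q z"
    and Inf: "Inf \<in> \<Gamma> \<Longrightarrow> degree p \<le> degree q \<and>
          f Inf = (if degree p = degree q then lead_coeff p / lead_coeff q else 0)"
    using assms(1) unfolding regular_on_def by blast
  define N where "N = max (degree p) (degree q)"
  note form = regular_on_binary_form[OF q Fin Inf N_def]
  define P where "P = form_pullback N p a b c d"
  define Q where "Q = form_pullback N q a b c d"
  have pullback_Fin: "poly Q z \<noteq> 0 \<and> (f \<circ> m) (Fin z) = poly P z / poly Q z" if "Fin z \<in> m -` \<Gamma>" for z
    using form[where x = "a * z + b" and y = "c * z + d"] that linear_map_nonzero[OF det, of z 1]
    by (simp add: P_def Q_def poly_form_pullback m moeb_Fin del: moeb.simps)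
  have pullback_Inf: "coeff Q N \<noteq> 0 \<and> (f \<circ> m) Inf = coeff P N / coeff Q N" if "Inf \<in> m -` \<Gamma>"
    using form[where x = a and y = c] that linear_map_nonzero[OF det, of 1 0]
    by (simp add: P_def Q_def coeff_form_pullback_top m moeb_Inf del: moeb.simps)
  have deg: "degree P \<le> N" "degree Q \<le> N"
    by (simp_all add: P_def Q_def degree_form_pullback_le)
  show ?thesis
  proof (cases "Q = 0")
    case False
    have "degree P \<le> degree Q \<and>
        (f \<circ> m) Inf = (if degree P = degree Q then lead_coeff P / lead_coeff Q else 0)"
      if "Inf \<in> m -` \<Gamma>"
    proof -
      have "degree Q = N"
        using deg(2) pullback_Inf[OF that] le_degree[of Q N] by auto
      then show ?thesis
        using deg(1) pullback_Inf[OF that] by (auto simp: coeff_eq_0)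
    qed
    with False pullback_Fin show ?thesis
      unfolding regular_on_def by blast
  next
    \<comment> \<open>A zero denominator leaves no point in the preimage, so any fraction
      serves.\<close>
    case True
    then have "z \<notin> m -` \<Gamma>" for z
      using pullback_Fin pullback_Inf by (cases z) auto
    then show ?thesis
      unfolding regular_on_def by (intro exI[of _ 0] exI[of _ 1]) auto
  qed
qed

section \<open>Transport of equivariant embeddings by Moebius conjugation\<close>

definition equivariantly_embeddable :: "p1 set \<Rightarrow> (p1 \<Rightarrow> p1) \<Rightarrow> bool" where
  "equivariantly_embeddable \<Lambda> g \<longleftrightarrow>
     (\<exists>\<tau> h. closed_emb (UNIV - \<Lambda>) \<tau> \<and> aut_A2 h \<and> (\<forall>z\<in>UNIV - \<Lambda>. h (\<tau> z) = \<tau> (g z)))"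

lemma closed_emb_moebius:
  assumes "closed_emb \<Gamma> \<tau>" "moebius m" "moebius n" "\<And>z. m (n z) = z" "\<And>z. n (m z) = z"
  shows "closed_emb (m -` \<Gamma>) (\<tau> \<circ> m)"
proof -
  have "regular_on (m -` \<Gamma>) (fst \<circ> (\<tau> \<circ> m))" "regular_on (m -` \<Gamma>) (snd \<circ> (\<tau> \<circ> m))"
    using assms(1) regular_on_moebius[OF _ assms(2)] unfolding closed_emb_def o_assoc by simp_all
  moreover have "\<exists>F. poly2 F \<and> (\<forall>z\<in>m -` \<Gamma>. f z = F ((\<tau> \<circ> m) z))" if f: "regular_on (m -` \<Gamma>) f" for f
  proof -
    have "n -` (m -` \<Gamma>) = \<Gamma>"
      by (auto simp: assms(4))
    then have "regular_on \<Gamma> (f \<circ> n)"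
      using regular_on_moebius[OF f assms(3)] by simp
    then obtain F where "poly2 F" "\<forall>z\<in>\<Gamma>. (f \<circ> n) z = F (\<tau> z)"
      using assms(1) unfolding closed_emb_def by blast
    then show ?thesis
      using assms(5) by (intro exI[of _ F]) force
  qed
  ultimately show ?thesis
    unfolding closed_emb_def by blast
qed

text \<open>The plane automorphism stays the same; only the embedding is precomposed with
  \<open>m\<close>.\<close>

lemma equivariantly_embeddable_conjugate:
  assumes "equivariantly_embeddable \<Lambda> g" "moebius m" "moebius n" "\<And>z. m (n z) = z" "\<And>z. n (m z) = z"
  shows "equivariantly_embeddable (m -` \<Lambda>) (n \<circ> g \<circ> m)"
proof -
  obtain \<tau> h where \<tau>: "closed_emb (UNIV - \<Lambda>) \<tau>" and h: "aut_A2 h"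
    and equiv: "\<forall>z\<in>UNIV - \<Lambda>. h (\<tau> z) = \<tau> (g z)"
    using assms(1) unfolding equivariantly_embeddable_def by blast
  have "closed_emb (UNIV - m -` \<Lambda>) (\<tau> \<circ> m)"
    using closed_emb_moebius[OF \<tau> assms(2-5)] by (simp add: vimage_Diff)
  moreover have "\<forall>z\<in>UNIV - m -` \<Lambda>. h ((\<tau> \<circ> m) z) = (\<tau> \<circ> m) ((n \<circ> g \<circ> m) z)"
    using equiv assms(4) by simp
  ultimately show ?thesis
    using h unfolding equivariantly_embeddable_def by blast
qed

lemma curve_aut_conjugate:
  assumes "curve_aut \<Lambda> g" "moebius m" "moebius n" "\<And>z. m (n z) = z" "\<And>z. n (m z) = z"
  shows "curve_aut (m -` \<Lambda>) (n \<circ> g \<circ> m)"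
proof -
  have g: "moebius g" "g ` \<Lambda> = \<Lambda>"
    using assms(1) by (simp_all add: curve_aut_iff)
  have "m -` \<Lambda> = n ` \<Lambda>"
    using assms(4,5) by (auto simp: image_iff) metis
  moreover have "m ` n ` \<Lambda> = \<Lambda>"
    using assms(4) by (simp add: image_image)
  ultimately have "(n \<circ> g \<circ> m) ` (m -` \<Lambda>) = m -` \<Lambda>"
    by (simp only: image_comp[symmetric] g(2))
  moreover have "moebius (n \<circ> g \<circ> m)"
    using assms(2,3) g(1) by (intro moebius_comp)
  ultimately show ?thesis
    by (simp add: curve_aut_iff)
qed

section \<open>Equivariant embeddings\<close>

lemma moebius_has_fixed_point:
  assumes "moebius g"
  shows "\<exists>p. g p = p"
proof -
  obtain a b c d where det: "a * d - b * c \<noteq> 0" and g: "g = moeb a b c d"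
    using assms by (auto simp: moebius_def)
  show ?thesis
  proof (cases "c = 0")
    case True
    then show ?thesis by (intro exI[of _ Inf]) (simp add: g)
  next
    case False
    \<comment> \<open>The fixed-point equation \<open>c z^2 + (d - a) z - b = 0\<close>. At a root
      the denominator is non-zero, since otherwise the numerator would vanish too.\<close>
    then have "\<not> constant (poly [:- b, d - a, c:])"
      by (simp add: constant_degree)
    then obtain z where "poly [:- b, d - a, c:] z = 0"
      using fundamental_theorem_of_algebra by blast
    then have z: "a * z + b = z * (c * z + d)"
      by (simp add: algebra_simps)
    then have "c * z + d \<noteq> 0"
      using linear_map_nonzero[OF det, of z 1] by auto
    then have "g (Fin z) = Fin z"
      by (simp add: g z)
    then show ?thesis ..
  qed
qed

lemma moebius_fixing_Inf:
  assumes "moebius g" "g Inf = Inf"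
  shows "\<exists>\<alpha> \<beta>. \<alpha> \<noteq> 0 \<and> (\<forall>z. g (Fin z) = Fin (\<alpha> * z + \<beta>))"
proof -
  obtain a b c d where det: "a * d - b * c \<noteq> 0" and g: "g = moeb a b c d"
    using assms by (auto simp: moebius_def)
  have "c = 0"
    using assms(2) by (simp add: g split: if_splits)
  with det have "a \<noteq> 0" "d \<noteq> 0"
    by auto
  with \<open>c = 0\<close> show ?thesis
    by (intro exI[of _ "a / d"] exI[of _ "b / d"]) (simp add: g add_divide_distrib)
qed

lemma finite_Fin_vimage: "finite \<Lambda> \<Longrightarrow> finite (Fin -` \<Lambda>)"
  by (rule finite_vimageI) (auto intro: injI)

lemma affine_image_eq:
  fixes \<alpha> :: complex
  assumes "finite \<Lambda>" "g ` \<Lambda> = \<Lambda>" "\<alpha> \<noteq> 0" "\<And>z. g (Fin z) = Fin (\<alpha> * z + \<beta>)"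
  shows "inj_on (\<lambda>z. \<alpha> * z + \<beta>) (Fin -` \<Lambda>)" "(\<lambda>z. \<alpha> * z + \<beta>) ` (Fin -` \<Lambda>) = Fin -` \<Lambda>"
proof -
  show inj: "inj_on (\<lambda>z. \<alpha> * z + \<beta>) (Fin -` \<Lambda>)"
    using assms(3) by (auto intro: inj_onI)
  have "(\<lambda>z. \<alpha> * z + \<beta>) ` (Fin -` \<Lambda>) \<subseteq> Fin -` \<Lambda>"
  proof clarsimp
    fix z assume "Fin z \<in> \<Lambda>"
    then have "g (Fin z) \<in> \<Lambda>"
      using assms(2) by blast
    then show "Fin (\<alpha> * z + \<beta>) \<in> \<Lambda>"
      by (simp add: assms(4))
  qed
  then show "(\<lambda>z. \<alpha> * z + \<beta>) ` (Fin -` \<Lambda>) = Fin -` \<Lambda>"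
    using finite_Fin_vimage[OF assms(1)] inj by (intro endo_inj_surj)
qed

text \<open>The curve is embedded as \<open>y q(x) = 1\<close>, where \<open>q\<close> is the monic polynomial with simple roots at
  the finite points of \<open>\<Lambda>\<close>; an affine map preserving these points multiplies \<open>q\<close> by a constant.\<close>
lemma equivariantly_embeddable_affine:
  assumes "finite \<Lambda>" "Inf \<in> \<Lambda>" "g ` \<Lambda> = \<Lambda>" "\<alpha> \<noteq> 0" "\<And>z. g (Fin z) = Fin (\<alpha> * z + \<beta>)"
  shows "equivariantly_embeddable \<Lambda> g"
proof -
  define S where "S = Fin -` \<Lambda>"
  have finS: "finite S"
    unfolding S_def using assms(1) by (rule finite_Fin_vimage)
  note affine = affine_image_eq[OF assms(1,3,4,5), folded S_def]
  define q where "q = (\<Prod>s\<in>S. [:- s, 1:])"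
  have poly_q: "poly q t = (\<Prod>s\<in>S. t - s)" for t
    by (simp add: q_def poly_prod)
  have q_root: "poly q t = 0 \<longleftrightarrow> t \<in> S" for t
    using finS by (auto simp: poly_q)
  \<comment> \<open>The affine map permutes \<open>S\<close>, so the product can be reindexed along
    it, and each factor gains \<open>\<alpha>\<close>.\<close>
  have q_affine: "poly q (\<alpha> * t + \<beta>) = \<alpha> ^ card S * poly q t" for t
  proof -
    have "poly q (\<alpha> * t + \<beta>) = (\<Prod>s\<in>(\<lambda>z. \<alpha> * z + \<beta>) ` S. \<alpha> * t + \<beta> - s)"
      by (simp only: affine(2) poly_q)
    also have "\<dots> = (\<Prod>s\<in>S. \<alpha> * t + \<beta> - (\<alpha> * s + \<beta>))"
      by (subst prod.reindex[OF affine(1)]) (simp only: o_def)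
    also have "\<dots> = (\<Prod>s\<in>S. \<alpha> * (t - s))"
      by (simp add: right_diff_distrib)
    finally show ?thesis
      by (simp only: prod.distrib prod_constant poly_q)
  qed
  define \<tau> where "\<tau> z = (case z of Fin t \<Rightarrow> (t, 1 / poly q t) | Inf \<Rightarrow> (0, 0))" for z
  define h :: "complex \<times> complex \<Rightarrow> complex \<times> complex"
    where "h z = (\<alpha> * fst z + \<beta>, inverse (\<alpha> ^ card S) * snd z)" for z
  define k :: "complex \<times> complex \<Rightarrow> complex \<times> complex"
    where "k z = (inverse \<alpha> * (fst z - \<beta>), \<alpha> ^ card S * snd z)" for z
  have "poly_map2 h" "poly_map2 k"
    unfolding poly_map2_def o_def h_def k_def fst_conv snd_conv
    by (intro conjI poly2_add poly2_diff poly2_mult poly2_const poly2_fst poly2_snd)+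
  moreover have "h (k z) = z" "k (h z) = z" for z
    using assms(4) by (simp_all add: h_def k_def mult.assoc[symmetric] prod_eq_iff)
  then have "h \<circ> k = id" "k \<circ> h = id"
    by (simp_all add: fun_eq_iff)
  ultimately have "aut_A2 h"
    unfolding aut_A2_def by blast
  moreover have "h (\<tau> z) = \<tau> (g z)" if "z \<in> UNIV - \<Lambda>" for z
    using that assms(2) by (cases z) (simp_all add: \<tau>_def h_def assms(5) q_affine divide_inverse)
  moreover have "closed_emb (UNIV - \<Lambda>) \<tau>"
    unfolding closed_emb_def
  proof (intro conjI allI impI)
    show "regular_on (UNIV - \<Lambda>) (fst \<circ> \<tau>)"
      unfolding regular_on_def using assms(2)
      by (intro exI[of _ "[:0, 1:]"] exI[of _ 1]) (simp add: \<tau>_def)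
    have "q \<noteq> 0"
      by (simp add: q_def finS)
    then show "regular_on (UNIV - \<Lambda>) (snd \<circ> \<tau>)"
      unfolding regular_on_def using assms(2)
      by (intro exI[of _ 1] exI[of _ q]) (simp add: \<tau>_def q_root S_def)
  next
    fix f assume "regular_on (UNIV - \<Lambda>) f"
    then obtain p r where r: "r \<noteq> 0"
      and f: "\<And>t. Fin t \<in> UNIV - \<Lambda> \<Longrightarrow> poly r t \<noteq> 0 \<and> f (Fin t) = poly p t / poly r t"
      unfolding regular_on_def by blast
    have "poly q t = 0" if "poly r t = 0" for t
      using f[of t] that by (auto simp: q_root S_def)
    \<comment> \<open>All roots of \<open>r\<close> lie in \<open>S\<close>. Hence
      \<open>1 / r = u / q ^ degree r\<close> on the curve, where \<open>1 / q\<close> is the second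
      coordinate.\<close>
    then have "r dvd q ^ degree r"
      using r nullstellensatz_univariate[of r q] by blast
    then obtain u where u: "q ^ degree r = r * u" ..
    define F where "F z = poly (p * u) (fst z) * poly (monom 1 (degree r)) (snd z)"
      for z :: "complex \<times> complex"
    have "poly2 F"
      unfolding F_def by (intro poly2_mult poly2_poly poly2_fst poly2_snd)
    moreover have "f z = F (\<tau> z)" if z\<Lambda>: "z \<in> UNIV - \<Lambda>" for z
    proof -
      obtain t where z: "z = Fin t"
        using z\<Lambda> assms(2) by (cases z) auto
      have "poly q t \<noteq> 0"
        using z\<Lambda> by (simp add: q_root S_def z)
      moreover have "poly q t ^ degree r = poly r t * poly u t"
        using arg_cong[OF u, of "\<lambda>p. poly p t"] by simp
      ultimately show ?thesis
        using f[of t] z\<Lambda> by (auto simp: F_def \<tau>_def z poly_monom power_divide)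
    qed
    ultimately show "\<exists>F. poly2 F \<and> (\<forall>z\<in>UNIV - \<Lambda>. f z = F (\<tau> z))"
      by (intro exI[of _ F]) simp
  qed
  ultimately show ?thesis
    unfolding equivariantly_embeddable_def by blast
qed

text \<open>The key case is a \<open>g\<close> with a single fixed point, lying outside \<open>\<Lambda>\<close>: moved to infinity, \<open>g\<close> is a
  translation, and it cannot preserve the sum of the points of \<open>\<Lambda>\<close>.\<close>
lemma curve_aut_fixed_point_in_boundary:
  assumes "finite \<Lambda>" "\<Lambda> \<noteq> {}" "curve_aut \<Lambda> g"
    and unique: "\<And>z w. z \<notin> \<Lambda> \<Longrightarrow> w \<notin> \<Lambda> \<Longrightarrow> g z = z \<Longrightarrow> g w = w \<Longrightarrow> z = w"
  shows "\<exists>p\<in>\<Lambda>. g p = p"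
proof (rule ccontr)
  assume no_fixed: "\<not> ?thesis"
  have "moebius g"
    using assms(3) by (simp add: curve_aut_iff)
  then obtain p where p: "g p = p"
    using moebius_has_fixed_point by blast
  then have "p \<notin> \<Lambda>"
    using no_fixed by blast
  obtain m where m: "moebius m" "m Inf = p"
    by (rule moebius_from_Inf)
  obtain n where n: "moebius n" "\<And>z. m (n z) = z" "\<And>z. n (m z) = z"
    using moebius_inverse[OF m(1)] by blast
  define g' where "g' = n \<circ> g \<circ> m"
  define \<Lambda>' where "\<Lambda>' = m -` \<Lambda>"
  have aut: "curve_aut \<Lambda>' g'"
    unfolding g'_def \<Lambda>'_def using assms(3) m(1) n by (rule curve_aut_conjugate)
  have fixed_iff: "g' z = z \<longleftrightarrow> g (m z) = m z" for z
    using n(2,3) unfolding g'_def o_apply by metis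
  have fin: "finite \<Lambda>'"
    unfolding \<Lambda>'_def using assms(1) n(3) by (intro finite_vimageI) (auto intro: inj_on_inverseI)
  have "g' Inf = Inf"
    using p m(2) by (simp add: fixed_iff)
  then obtain \<alpha> \<beta> where \<alpha>: "\<alpha> \<noteq> 0" and g': "\<And>z. g' (Fin z) = Fin (\<alpha> * z + \<beta>)"
    using moebius_fixing_Inf[of g'] aut unfolding curve_aut_iff by blast
  have no_fixed': "g' (Fin z) \<noteq> Fin z" for z
  proof
    assume "g' (Fin z) = Fin z"
    then have z: "g (m (Fin z)) = m (Fin z)"
      by (simp only: fixed_iff)
    \<comment> \<open>This point is outside \<open>\<Lambda>\<close> by \<open>no_fixed\<close>, as
      is \<open>p\<close>; uniqueness on the curve identifies them.\<close>
    then have "m (Fin z) = m Inf"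
      using no_fixed z unique[OF _ \<open>p \<notin> \<Lambda>\<close> z p] unfolding m(2) by blast
    then show False
      using n(3) by (metis p1.distinct(1))
  qed
  have "\<alpha> = 1"
  proof (rule ccontr)
    assume "\<alpha> \<noteq> 1"
    then have "g' (Fin (\<beta> / (1 - \<alpha>))) = Fin (\<beta> / (1 - \<alpha>))"
      by (simp add: g' field_simps)
    then show False
      using no_fixed' by blast
  qed
  define S where "S = Fin -` \<Lambda>'"
  have "g' ` \<Lambda>' = \<Lambda>'"
    using aut by (simp only: curve_aut_iff)
  note affine = affine_image_eq[OF fin this \<alpha> g', folded S_def]
  have "\<Sum>S = (\<Sum>s\<in>(\<lambda>z. \<alpha> * z + \<beta>) ` S. s)"
    by (simp only: affine(2))
  also have "\<dots> = \<Sum>S + of_nat (card S) * \<beta>"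
    unfolding sum.reindex[OF affine(1)] by (simp add: \<open>\<alpha> = 1\<close> sum.distrib)
  finally have "of_nat (card S) * \<beta> = 0"
    by simp
  moreover have "card S \<noteq> 0"
  proof -
    obtain z where "z \<in> \<Lambda>"
      using assms(2) by blast
    then have "n z \<in> \<Lambda>'"
      by (simp add: \<Lambda>'_def n(2))
    moreover have "n z \<noteq> Inf"
      using \<open>z \<in> \<Lambda>\<close> \<open>p \<notin> \<Lambda>\<close> n(2)[of z] m(2) by auto
    ultimately have "S \<noteq> {}"
      unfolding S_def by (cases "n z") auto
    then show ?thesis
      using finite_Fin_vimage[OF fin] by (simp add: S_def)
  qed
  \<comment> \<open>The translation length \<open>\<beta>\<close> is zero, so \<open>g'\<close>
    would fix every finite point.\<close>
  ultimately have "g' (Fin 0) = Fin 0"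
    by (simp add: g' \<open>\<alpha> = 1\<close>)
  then show False
    using no_fixed' by blast
qed

lemma equivariantly_embeddable_if_fixed_boundary_point:
  assumes "finite \<Lambda>" "curve_aut \<Lambda> g" "p \<in> \<Lambda>" "g p = p"
  shows "equivariantly_embeddable \<Lambda> g"
proof -
  obtain m where m: "moebius m" "m Inf = p"
    by (rule moebius_from_Inf)
  obtain n where n: "moebius n" "\<And>z. m (n z) = z" "\<And>z. n (m z) = z"
    using moebius_inverse[OF m(1)] by blast
  have aut: "curve_aut (m -` \<Lambda>) (n \<circ> g \<circ> m)"
    using assms(2) m(1) n by (rule curve_aut_conjugate)
  have "(n \<circ> g \<circ> m) Inf = Inf"
    using assms(4) m(2) n(3)[of Inf] by simp
  then obtain \<alpha> \<beta> where "\<alpha> \<noteq> 0" "\<And>z. (n \<circ> g \<circ> m) (Fin z) = Fin (\<alpha> * z + \<beta>)"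
    using moebius_fixing_Inf[of "n \<circ> g \<circ> m"] aut unfolding curve_aut_iff by blast
  moreover have "finite (m -` \<Lambda>)"
    using assms(1) n(3) by (intro finite_vimageI) (auto intro: inj_on_inverseI)
  moreover have "Inf \<in> m -` \<Lambda>"
    using assms(3) m(2) by simp
  moreover have "(n \<circ> g \<circ> m) ` (m -` \<Lambda>) = m -` \<Lambda>"
    using aut by (simp only: curve_aut_iff)
  ultimately have "equivariantly_embeddable (m -` \<Lambda>) (n \<circ> g \<circ> m)"
    by (intro equivariantly_embeddable_affine)
  then have "equivariantly_embeddable (n -` (m -` \<Lambda>)) (m \<circ> (n \<circ> g \<circ> m) \<circ> n)"
    using n(1) m(1) n(3,2) by (rule equivariantly_embeddable_conjugate)
  moreover have "n -` (m -` \<Lambda>) = \<Lambda>" "m \<circ> (n \<circ> g \<circ> m) \<circ> n = g"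
    using n(2) by (auto simp: fun_eq_iff)
  ultimately show ?thesis by simp
qed

section \<open>The obstruction from two fixed points\<close>

text \<open>The multiplier at a fixed point \<open>t\<close> is the determinant over
  \<open>(c * t + d) ^ 2\<close>. Comparing the two values by means of Vieta's formula leaves trace
  zero or the identity, and a 2x2 matrix of trace zero squares to a scalar.\<close>

lemma involution_if_two_fixed_points_affine:
  assumes "finite \<Lambda>" "Inf \<in> \<Lambda>" "curve_aut \<Lambda> g" "equivariantly_embeddable \<Lambda> g"
    and "Fin t1 \<notin> \<Lambda>" "Fin t2 \<notin> \<Lambda>" "t1 \<noteq> t2" "g (Fin t1) = Fin t1" "g (Fin t2) = Fin t2"
  shows "g (g z) = z"
proof -
  obtain a b c d where det: "a * d - b * c \<noteq> 0" and g: "g = moeb a b c d" and g\<Lambda>: "g ` \<Lambda> = \<Lambda>"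
    using assms(3) by (auto simp: curve_aut_def)
  have "moebius g"
    unfolding moebius_def using det g by blast
  then obtain n where n: "\<And>z. g (n z) = z" "\<And>z. n (g z) = z"
    using moebius_inverse by blast
  obtain \<tau> h where \<tau>: "closed_emb (UNIV - \<Lambda>) \<tau>" and h: "aut_A2 h"
    and equiv: "\<forall>z\<in>UNIV - \<Lambda>. h (\<tau> z) = \<tau> (g z)"
    using assms(4) unfolding equivariantly_embeddable_def by blast
  define S where "S = Fin -` \<Lambda>"
  define X where "X t = fst (\<tau> (Fin t))" for t
  define Y where "Y t = snd (\<tau> (Fin t))" for t
  have \<tau>_eq: "\<tau> (Fin t) = (X t, Y t)" for t
    by (simp add: X_def Y_def)
  have regular: "rational_off S (\<lambda>t. f (Fin t))" if "regular_on (UNIV - \<Lambda>) f" for f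
    using that unfolding regular_on_def rational_off_def S_def by auto
  interpret affine_plane_curve S X Y
  proof
    show "finite S"
      unfolding S_def using assms(1) by (rule finite_Fin_vimage)
    show "rational_off S X" "rational_off S Y"
      using regular \<tau> unfolding X_def Y_def closed_emb_def o_def by blast+
    show "\<exists>F. poly2 F \<and> (\<forall>t. t \<notin> S \<longrightarrow> f t = F (X t, Y t))" if f: "rational_off S f" for f
    proof -
      \<comment> \<open>The value 0 at \<open>Inf\<close> is a dummy, as \<open>Inf\<close> is not
        on the curve.\<close>
      have "regular_on (UNIV - \<Lambda>) (\<lambda>z. case z of Fin t \<Rightarrow> f t | Inf \<Rightarrow> 0)"
        using f assms(2) unfolding regular_on_def rational_off_def S_def by auto
      then obtain F where "poly2 F" "\<forall>z\<in>UNIV - \<Lambda>. (case z of Fin t \<Rightarrow> f t | Inf \<Rightarrow> 0) = F (\<tau> z)"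
        using \<tau> unfolding closed_emb_def by blast
      then show ?thesis
        by (intro exI[of _ F]) (force simp: S_def \<tau>_eq)
    qed
  qed
  define \<gamma> where "\<gamma> t = (a * t + b) / (c * t + d)" for t
  have g_Fin: "c * t + d \<noteq> 0 \<and> g (Fin t) = Fin (\<gamma> t) \<and> \<gamma> t \<notin> S" if "t \<notin> S" for t
  proof -
    have "g (Fin t) \<notin> \<Lambda>"
    proof
      assume "g (Fin t) \<in> \<Lambda>"
      then obtain z where "z \<in> \<Lambda>" "g z = g (Fin t)"
        using g\<Lambda> by (metis imageE)
      then show False
        using that n(2) by (metis S_def vimage_eq)
    qed
    moreover from this have "c * t + d \<noteq> 0"
      using assms(2) by (auto simp: g)
    ultimately show ?thesis
      by (simp add: g \<gamma>_def S_def)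
  qed
  have "\<gamma> ` (- S) = - S"
  proof
    show "\<gamma> ` (- S) \<subseteq> - S"
      using g_Fin by auto
    show "- S \<subseteq> \<gamma> ` (- S)"
    proof
      fix t assume t: "t \<in> - S"
      have "n (Fin t) \<notin> \<Lambda>"
      proof
        assume "n (Fin t) \<in> \<Lambda>"
        then have "g (n (Fin t)) \<in> \<Lambda>"
          using g\<Lambda> by blast
        with t show False
          by (simp add: n(1) S_def)
      qed
      moreover from this obtain u where u: "n (Fin t) = Fin u"
        using assms(2) by (cases "n (Fin t)") auto
      ultimately have "u \<notin> S"
        by (simp add: S_def)
      moreover have "g (Fin u) = Fin t"
        using n(1)[of "Fin t"] u by simp
      ultimately show "t \<in> \<gamma> ` (- S)"
        using g_Fin[of u] by (intro image_eqI[of _ _ u]) auto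
    qed
  qed
  have equiv': "h (X t, Y t) = (X (\<gamma> t), Y (\<gamma> t))" if "t \<notin> S" for t
    using equiv[rule_format, of "Fin t"] that g_Fin[OF that] by (simp add: \<tau>_eq S_def)
  have t: "t1 \<notin> S" "t2 \<notin> S"
    using assms(5,6) by (simp_all add: S_def)
  have fixed: "\<gamma> t1 = t1" "\<gamma> t2 = t2"
    using g_Fin[OF t(1)] g_Fin[OF t(2)] assms(8,9) by simp_all
  have deriv: "(\<gamma> has_field_derivative (a * d - b * c) / (c * t + d) ^ 2) (at t)" if "t \<notin> S" for t
    unfolding \<gamma>_def using g_Fin[OF that]
    by (auto intro!: derivative_eq_intros simp: field_simps power2_eq_square)
  have "(a * d - b * c) / (c * t1 + d) ^ 2 = (a * d - b * c) / (c * t2 + d) ^ 2"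
    using fixed_point_multipliers_eq[OF h \<open>\<gamma> ` (- S) = - S\<close> equiv'
        t(1) fixed(1) deriv[OF t(1)] t(2) fixed(2) deriv[OF t(2)]] .
  then have squares: "(c * t1 + d) ^ 2 = (c * t2 + d) ^ 2"
    using det g_Fin[OF t(1)] g_Fin[OF t(2)] by (simp add: frac_eq_eq)
  have fixed_eq: "a * t1 + b = t1 * (c * t1 + d)" "a * t2 + b = t2 * (c * t2 + d)"
    using fixed g_Fin[OF t(1)] g_Fin[OF t(2)] by (simp_all add: \<gamma>_def divide_eq_eq)
  \<comment> \<open>Difference of the two fixed-point equations: the sum of roots of the
    quadratic.\<close>
  then have "(t1 - t2) * (c * (t1 + t2) - (a - d)) = 0"
    by algebra
  with assms(7) have vieta: "c * (t1 + t2) = a - d"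
    by simp
  from squares have "(t1 - t2) * c * (c * (t1 + t2) + 2 * d) = 0"
    by algebra
  with assms(7) vieta have "c = 0 \<or> (a - d) + 2 * d = 0"
    by simp
  then have "c = 0 \<or> a + d = 0"
    by (simp add: algebra_simps)
  \<comment> \<open>If \<open>c = 0\<close>, the Vieta relation gives \<open>a = d\<close>, and the
    fixed-point equation then gives \<open>b = 0\<close>.\<close>
  then have alternatives: "a + d = 0 \<or> c = 0 \<and> a = d \<and> b = 0"
    using vieta fixed_eq(1) by auto
  obtain x y where z: "z = proj_pt x y" "x \<noteq> 0 \<or> y \<noteq> 0"
    by (rule proj_pt_cases)
  have gg: "g (g z) = proj_pt ((a * a + b * c) * x + b * (a + d) * y) (c * (a + d) * x + (d * d + b * c) * y)"
    using linear_map_nonzero[OF det z(2)] z by (simp add: g moeb_proj_pt algebra_simps)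
  from alternatives show ?thesis
  proof
    assume "a + d = 0"
    then have "d = - a"
      by (simp add: add_eq_0_iff)
    then show ?thesis
      using det gg z(1) by (simp add: proj_pt_scale add_eq_0_iff)
  next
    assume "c = 0 \<and> a = d \<and> b = 0"
    then show ?thesis
      using det gg z(1) by (simp add: proj_pt_scale)
  qed
qed

lemma involution_if_two_fixed_points:
  assumes "finite \<Lambda>" "\<Lambda> \<noteq> {}" "curve_aut \<Lambda> g" "equivariantly_embeddable \<Lambda> g"
    and "z1 \<notin> \<Lambda>" "z2 \<notin> \<Lambda>" "z1 \<noteq> z2" "g z1 = z1" "g z2 = z2"
  shows "g (g z) = z"
proof -
  obtain p where "p \<in> \<Lambda>"
    using assms(2) by blast
  obtain m where m: "moebius m" "m Inf = p"
    by (rule moebius_from_Inf)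
  obtain n where n: "moebius n" "\<And>z. m (n z) = z" "\<And>z. n (m z) = z"
    using moebius_inverse[OF m(1)] by blast
  \<comment> \<open>In the new coordinate infinity is the boundary point \<open>p\<close>, so points
    of the curve are finite.\<close>
  have finite_coord: "\<exists>t. n z = Fin t" if "z \<notin> \<Lambda>" for z
    using that \<open>p \<in> \<Lambda>\<close> m(2) n(2)[of z] by (cases "n z") auto
  obtain t1 t2 where t: "n z1 = Fin t1" "n z2 = Fin t2"
    using finite_coord assms(5,6) by blast
  then have mt: "m (Fin t1) = z1" "m (Fin t2) = z2"
    using n(2) by metis+
  have "(n \<circ> g \<circ> m) ((n \<circ> g \<circ> m) (n z)) = n z"
  proof (rule involution_if_two_fixed_points_affine)
    show "finite (m -` \<Lambda>)"
      using assms(1) n(3) by (intro finite_vimageI) (auto intro: inj_on_inverseI)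
    show "Inf \<in> m -` \<Lambda>"
      using \<open>p \<in> \<Lambda>\<close> m(2) by simp
    show "curve_aut (m -` \<Lambda>) (n \<circ> g \<circ> m)"
      using assms(3) m(1) n by (rule curve_aut_conjugate)
    show "equivariantly_embeddable (m -` \<Lambda>) (n \<circ> g \<circ> m)"
      using assms(4) m(1) n by (rule equivariantly_embeddable_conjugate)
    show "Fin t1 \<notin> m -` \<Lambda>" "Fin t2 \<notin> m -` \<Lambda>" "t1 \<noteq> t2"
      "(n \<circ> g \<circ> m) (Fin t1) = Fin t1" "(n \<circ> g \<circ> m) (Fin t2) = Fin t2"
      using assms(5-9) mt t by auto
  qed
  then have "n (g (g z)) = n z"
    by (simp add: n(2))
  then show ?thesis
    using n(2) by metis
qed

theorem mainTheorem6:
  fixes \<Lambda> :: "p1 set" and g :: "p1 \<Rightarrow> p1"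
  assumes "finite \<Lambda>" and "\<Lambda> \<noteq> {}" and "curve_aut \<Lambda> g"
  shows "((\<forall>z\<in>UNIV - \<Lambda>. \<forall>w\<in>UNIV - \<Lambda>. g z = z \<longrightarrow> g w = w \<longrightarrow> z = w) \<longrightarrow>
           (\<exists>\<tau> h. closed_emb (UNIV - \<Lambda>) \<tau> \<and> aut_A2 h \<and> (\<forall>z\<in>UNIV - \<Lambda>. h (\<tau> z) = \<tau> (g z))))
       \<and> (\<forall>n. aut_order g n \<and> n > 1 \<and> odd n \<and> card {z\<in>UNIV - \<Lambda>. g z = z} = 2 \<longrightarrow>
           \<not> (\<exists>\<tau> h. closed_emb (UNIV - \<Lambda>) \<tau> \<and> aut_A2 h \<and> (\<forall>z\<in>UNIV - \<Lambda>. h (\<tau> z) = \<tau> (g z))))"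
  unfolding equivariantly_embeddable_def[symmetric]
proof (intro conjI impI allI)
  assume "\<forall>z\<in>UNIV - \<Lambda>. \<forall>w\<in>UNIV - \<Lambda>. g z = z \<longrightarrow> g w = w \<longrightarrow> z = w"
  then have "\<exists>p\<in>\<Lambda>. g p = p"
    by (intro curve_aut_fixed_point_in_boundary[OF assms]) simp
  then show "equivariantly_embeddable \<Lambda> g"
    using equivariantly_embeddable_if_fixed_boundary_point[OF assms(1,3)] by blast
next
  fix n
  assume n: "aut_order g n \<and> n > 1 \<and> odd n \<and> card {z\<in>UNIV - \<Lambda>. g z = z} = 2"
  show "\<not> equivariantly_embeddable \<Lambda> g"
  proof
    assume emb: "equivariantly_embeddable \<Lambda> g"
    obtain z1 z2 where "{z\<in>UNIV - \<Lambda>. g z = z} = {z1, z2}" "z1 \<noteq> z2"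
      using n by (auto simp: card_2_iff)
    then have "z1 \<notin> \<Lambda>" "z2 \<notin> \<Lambda>" "g z1 = z1" "g z2 = z2"
      by blast+
    with assms emb \<open>z1 \<noteq> z2\<close> have gg: "g (g z) = z" for z
      by (intro involution_if_two_fixed_points[of \<Lambda> g z1 z2])
    \<comment> \<open>An odd power of an involution is the involution itself, so \<open>g\<close>
      would be the identity, against order greater than 1.\<close>
    from n obtain k where "n = 2 * k + 1"
      by (auto elim: oddE)
    moreover have "g ^^ (2 * k) = id"
      by (induction k) (simp_all add: fun_eq_iff gg)
    ultimately have "g ^^ n = g"
      by simp
    with n have "g ^^ 1 = id"
      by (simp add: aut_order_def)
    then show False
      using n unfolding aut_order_def by (metis zero_less_one)
  qed
qed

end
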